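(* Let $K$ be a field of characteristic $\ne 2$. There exist two commutative associative unital $K$-algebras $A$, $B$, a Poisson bracket $[\cdot,\cdot]_A$ on $A$, and a contact bracket $[\cdot,\cdot]_B$ on $B$, such that there is no contact bracket on $A \otimes_K B$ extending the brackets $[\cdot,\cdot]_A$ and $[\cdot,\cdot]_B$.
   Context: A bracket on a commutative associative unital $K$-algebra $A$ is a $K$-bilinear map $[\cdot,\cdot]: A \times A \to A$. A bracket is called contact if $(A,[\cdot,\cdot])$ is a Lie algebra over $K$ and the identity $[ab,c] = [a,c]b + [b,c]a + [c,1]ab$ holds for all $a,b,c\in A$. A Poisson bracket is a contact bracket such that $[a,1]=0$ for all $a \in A$. The tensor product $A\otimes_K B$ is the commutative associative unital algebra with multiplication $(a\otimes b)(a'\otimes b') = aa'\otimes bb'$. A bracket $[\cdot,\cdot]$ on $A\otimes_K B$ extends $[\cdot,\cdot]_A$ and $[\cdot,\cdot]_B$ if $[a\otimes 1, a'\otimes 1] = [a,a']_A\otimes 1$ for all $a,a'\in A$ and $[1\otimes b, 1\otimes b'] = 1\otimes [b,b']_B$ for all $b,b'\in B$. *)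

theory Defs
  imports "HOL-Algebra.Module" "HOL-Algebra.QuotRing" "HOL-Algebra.Multiplicative_Group"
begin

text \<open>
  The characteristic of a ring: the generator of the ideal of all \<open>n\<close> with \<open>n \<cdot> 1 = 0\<close>
  (so \<open>0\<close> if there is no positive such \<open>n\<close>).
\<close>
definition ring_char :: "('k, 'm) ring_scheme \<Rightarrow> nat"
  where "ring_char K = group.ord (add_monoid K) \<one>\<^bsub>K\<^esub>"


lemma ring_char_dvd:
  assumes "ring K"
  shows "add_pow K (n::nat) \<one>\<^bsub>K\<^esub> = \<zero>\<^bsub>K\<^esub> \<longleftrightarrow> ring_char K dvd n"
proof -
  interpret ring K by fact
  show ?thesis
    using add.pow_eq_id[of "\<one>\<^bsub>K\<^esub>" n] unfolding ring_char_def by (simp add: add_pow_def)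
qed


section \<open>Brackets on a commutative algebra\<close>

locale bracket = algebra K A for K (structure) and A (structure) +
  fixes br
  assumes br_closed: "\<lbrakk>a \<in> carrier A; b \<in> carrier A\<rbrakk> \<Longrightarrow> br a b \<in> carrier A"
    and br_add_left:
      "\<lbrakk>a \<in> carrier A; b \<in> carrier A; c \<in> carrier A\<rbrakk> \<Longrightarrow>
        br (a \<oplus>\<^bsub>A\<^esub> b) c = br a c \<oplus>\<^bsub>A\<^esub> br b c"
    and br_add_right:
      "\<lbrakk>a \<in> carrier A; b \<in> carrier A; c \<in> carrier A\<rbrakk> \<Longrightarrow>
        br a (b \<oplus>\<^bsub>A\<^esub> c) = br a b \<oplus>\<^bsub>A\<^esub> br a c"
    and br_smult_left:
      "\<lbrakk>k \<in> carrier K; a \<in> carrier A; b \<in> carrier A\<rbrakk> \<Longrightarrow>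
        br (k \<odot>\<^bsub>A\<^esub> a) b = k \<odot>\<^bsub>A\<^esub> br a b"
    and br_smult_right:
      "\<lbrakk>k \<in> carrier K; a \<in> carrier A; b \<in> carrier A\<rbrakk> \<Longrightarrow>
        br a (k \<odot>\<^bsub>A\<^esub> b) = k \<odot>\<^bsub>A\<^esub> br a b"

locale lie_bracket = bracket +
  assumes br_self: "a \<in> carrier A \<Longrightarrow> br a a = \<zero>\<^bsub>A\<^esub>"
    and jacobi:
      "\<lbrakk>a \<in> carrier A; b \<in> carrier A; c \<in> carrier A\<rbrakk> \<Longrightarrow>
        br a (br b c) \<oplus>\<^bsub>A\<^esub> br b (br c a) \<oplus>\<^bsub>A\<^esub> br c (br a b) = \<zero>\<^bsub>A\<^esub>"

locale contact_bracket = lie_bracket +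
  assumes contact_identity:
      "\<lbrakk>a \<in> carrier A; b \<in> carrier A; c \<in> carrier A\<rbrakk> \<Longrightarrow>
        br (a \<otimes>\<^bsub>A\<^esub> b) c =
          br a c \<otimes>\<^bsub>A\<^esub> b \<oplus>\<^bsub>A\<^esub> br b c \<otimes>\<^bsub>A\<^esub> a \<oplus>\<^bsub>A\<^esub> br c \<one>\<^bsub>A\<^esub> \<otimes>\<^bsub>A\<^esub> a \<otimes>\<^bsub>A\<^esub> b"

locale poisson_bracket = contact_bracket +
  assumes br_one: "a \<in> carrier A \<Longrightarrow> br a \<one>\<^bsub>A\<^esub> = \<zero>\<^bsub>A\<^esub>"


section \<open>Tensor product of commutative algebras\<close>

text \<open>
  The free \<open>K\<close>-module on the set \<open>carrier G\<close>, whose elements are the finitely supported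
  functions to \<open>K\<close>, with the \<open>K\<close>-bilinear extension of the multiplication of \<open>G\<close>.
\<close>
definition monoid_algebra ::
    "('k, 'm) ring_scheme \<Rightarrow> ('g, 'n) monoid_scheme \<Rightarrow> ('k, 'g \<Rightarrow> 'k) module"
  where "monoid_algebra K G =
    \<lparr>carrier = {f. range f \<subseteq> carrier K \<and> finite {p. f p \<noteq> \<zero>\<^bsub>K\<^esub>} \<and> {p. f p \<noteq> \<zero>\<^bsub>K\<^esub>} \<subseteq> carrier G},
     mult = (\<lambda>f g p. \<Oplus>\<^bsub>K\<^esub>x \<in> {(q, r). f q \<noteq> \<zero>\<^bsub>K\<^esub> \<and> g r \<noteq> \<zero>\<^bsub>K\<^esub> \<and> q \<otimes>\<^bsub>G\<^esub> r = p}.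
       f (fst x) \<otimes>\<^bsub>K\<^esub> g (snd x)),
     one = (\<lambda>p. if p = \<one>\<^bsub>G\<^esub> then \<one>\<^bsub>K\<^esub> else \<zero>\<^bsub>K\<^esub>),
     zero = (\<lambda>p. \<zero>\<^bsub>K\<^esub>),
     add = (\<lambda>f g p. f p \<oplus>\<^bsub>K\<^esub> g p),
     smult = (\<lambda>k f p. k \<otimes>\<^bsub>K\<^esub> f p)\<rparr>"

definition single :: "('k, 'm) ring_scheme \<Rightarrow> 'g \<Rightarrow> 'g \<Rightarrow> 'k"
  where "single K p = (\<lambda>q. if q = p then \<one>\<^bsub>K\<^esub> else \<zero>\<^bsub>K\<^esub>)"

definition module_span ::
    "('k, 'm) ring_scheme \<Rightarrow> ('k, 'a, 'n) module_scheme \<Rightarrow> 'a set \<Rightarrow> 'a set"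
  where "module_span K M S = \<Inter>{H. submodule H K M \<and> S \<subseteq> H}"

definition quotient_algebra :: "('k, 'a, 'n) module_scheme \<Rightarrow> 'a set \<Rightarrow> ('k, 'a set) module"
  where "quotient_algebra F I =
    \<lparr>carrier = carrier (F Quot I), mult = mult (F Quot I), one = one (F Quot I),
     zero = zero (F Quot I), add = add (F Quot I),
     smult = (\<lambda>k X. \<Union>x\<in>X. I +>\<^bsub>F\<^esub> (k \<odot>\<^bsub>F\<^esub> x))\<rparr>"

definition tensor_relations ::
    "('k, 'm) ring_scheme \<Rightarrow> ('k, 'a, 'n) module_scheme \<Rightarrow> ('k, 'b, 'l) module_scheme \<Rightarrow>
      ('a \<times> 'b \<Rightarrow> 'k) set"
  where "tensor_relations K A B = (let F = monoid_algebra K (A \<times>\<times> B) in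
      {single K (a \<oplus>\<^bsub>A\<^esub> a', b) \<ominus>\<^bsub>F\<^esub> (single K (a, b) \<oplus>\<^bsub>F\<^esub> single K (a', b)) | a a' b.
         a \<in> carrier A \<and> a' \<in> carrier A \<and> b \<in> carrier B} \<union>
      {single K (a, b \<oplus>\<^bsub>B\<^esub> b') \<ominus>\<^bsub>F\<^esub> (single K (a, b) \<oplus>\<^bsub>F\<^esub> single K (a, b')) | a b b'.
         a \<in> carrier A \<and> b \<in> carrier B \<and> b' \<in> carrier B} \<union>
      {single K (k \<odot>\<^bsub>A\<^esub> a, b) \<ominus>\<^bsub>F\<^esub> k \<odot>\<^bsub>F\<^esub> single K (a, b) | k a b.
         k \<in> carrier K \<and> a \<in> carrier A \<and> b \<in> carrier B} \<union>
      {single K (a, k \<odot>\<^bsub>B\<^esub> b) \<ominus>\<^bsub>F\<^esub> k \<odot>\<^bsub>F\<^esub> single K (a, b) | k a b.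
         k \<in> carrier K \<and> a \<in> carrier A \<and> b \<in> carrier B})"

definition tensor_kernel ::
    "('k, 'm) ring_scheme \<Rightarrow> ('k, 'a, 'n) module_scheme \<Rightarrow> ('k, 'b, 'l) module_scheme \<Rightarrow>
      ('a \<times> 'b \<Rightarrow> 'k) set"
  where "tensor_kernel K A B =
    module_span K (monoid_algebra K (A \<times>\<times> B)) (tensor_relations K A B)"

text \<open>
  The module underlying \<open>tensor_product K A B\<close> is the usual quotient of the free module on
  \<open>carrier A \<times> carrier B\<close> by the bilinearity relations.  The free module carries the
  multiplication of the monoid algebra of the product of the multiplicative monoids of
  \<open>A\<close> and \<open>B\<close>, which descends to \<open>(a \<otimes> b) (a' \<otimes> b') = a a' \<otimes> b b'\<close>.
\<close>
definition tensor_product ::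
    "('k, 'm) ring_scheme \<Rightarrow> ('k, 'a, 'n) module_scheme \<Rightarrow> ('k, 'b, 'l) module_scheme \<Rightarrow>
      ('k, ('a \<times> 'b \<Rightarrow> 'k) set) module"
  where "tensor_product K A B =
    quotient_algebra (monoid_algebra K (A \<times>\<times> B)) (tensor_kernel K A B)"

definition pure_tensor ::
    "('k, 'm) ring_scheme \<Rightarrow> ('k, 'a, 'n) module_scheme \<Rightarrow> ('k, 'b, 'l) module_scheme \<Rightarrow>
      'a \<Rightarrow> 'b \<Rightarrow> ('a \<times> 'b \<Rightarrow> 'k) set"
  where "pure_tensor K A B a b =
    tensor_kernel K A B +>\<^bsub>monoid_algebra K (A \<times>\<times> B)\<^esub> single K (a, b)"

definition extends_brackets ::
    "('k, 'm) ring_scheme \<Rightarrow> ('k, 'a, 'n) module_scheme \<Rightarrow> ('k, 'b, 'l) module_scheme \<Rightarrow>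
      ('a \<Rightarrow> 'a \<Rightarrow> 'a) \<Rightarrow> ('b \<Rightarrow> 'b \<Rightarrow> 'b) \<Rightarrow>
      (('a \<times> 'b \<Rightarrow> 'k) set \<Rightarrow> ('a \<times> 'b \<Rightarrow> 'k) set \<Rightarrow> ('a \<times> 'b \<Rightarrow> 'k) set) \<Rightarrow> bool"
  where "extends_brackets K A B brA brB br \<longleftrightarrow>
    (\<forall>a \<in> carrier A. \<forall>a' \<in> carrier A.
      br (pure_tensor K A B a \<one>\<^bsub>B\<^esub>) (pure_tensor K A B a' \<one>\<^bsub>B\<^esub>) =
        pure_tensor K A B (brA a a') \<one>\<^bsub>B\<^esub>) \<and>
    (\<forall>b \<in> carrier B. \<forall>b' \<in> carrier B.
      br (pure_tensor K A B \<one>\<^bsub>A\<^esub> b) (pure_tensor K A B \<one>\<^bsub>A\<^esub> b') =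
        pure_tensor K A B \<one>\<^bsub>A\<^esub> (brB b b'))"


section \<open>The tensor product is an algebra with the universal property\<close>

locale monoid_alg = K: cring K + G: comm_monoid G
  for K :: "('k, 'm) ring_scheme" (structure) and G :: "('g, 'n) monoid_scheme" (structure)
begin

abbreviation "F \<equiv> monoid_algebra K G"
abbreviation "supp f \<equiv> {p. f p \<noteq> \<zero>\<^bsub>K\<^esub>}"

lemma F_simps:
  "zero F = (\<lambda>p. \<zero>\<^bsub>K\<^esub>)" "add F f g = (\<lambda>p. f p \<oplus>\<^bsub>K\<^esub> g p)"
  "smult F k f = (\<lambda>p. k \<otimes>\<^bsub>K\<^esub> f p)" "one F = single K \<one>\<^bsub>G\<^esub>"
  by (auto simp: monoid_algebra_def single_def)

lemma F_carrier: "f \<in> carrier F \<longleftrightarrow> (\<forall>p. f p \<in> carrier K) \<and> finite (supp f) \<and> supp f \<subseteq> carrier G"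
  by (auto simp: monoid_algebra_def)

lemma F_app [simp]: "f \<in> carrier F \<Longrightarrow> f p \<in> carrier K"
  by (simp add: F_carrier)

lemma F_add_closed: "\<lbrakk>f \<in> carrier F; g \<in> carrier F\<rbrakk> \<Longrightarrow> f \<oplus>\<^bsub>F\<^esub> g \<in> carrier F"
proof -
  assume a: "f \<in> carrier F" "g \<in> carrier F"
  have "supp (f \<oplus>\<^bsub>F\<^esub> g) \<subseteq> supp f \<union> supp g" by (auto simp: F_simps)
  then show ?thesis using a unfolding F_carrier
    by (auto simp: F_simps intro: finite_subset)
qed

lemma F_smult_closed: "\<lbrakk>k \<in> carrier K; f \<in> carrier F\<rbrakk> \<Longrightarrow> k \<odot>\<^bsub>F\<^esub> f \<in> carrier F"
proof -
  assume a: "k \<in> carrier K" "f \<in> carrier F"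
  have "supp (k \<odot>\<^bsub>F\<^esub> f) \<subseteq> supp f" using a by (auto simp: F_simps)
  then show ?thesis using a unfolding F_carrier
    by (auto simp: F_simps intro: finite_subset)
qed

lemma F_zero_closed: "\<zero>\<^bsub>F\<^esub> \<in> carrier F"
  by (auto simp: F_carrier F_simps)

lemma single_closed: "p \<in> carrier G \<Longrightarrow> single K p \<in> carrier F"
proof -
  assume "p \<in> carrier G"
  moreover have "supp (single K p) \<subseteq> {p}" by (auto simp: single_def)
  ultimately show ?thesis unfolding F_carrier by (auto simp: single_def)
qed

lemma F_abelian: "abelian_group F"
proof (rule abelian_groupI)
  fix f assume f: "f \<in> carrier F"
  have s: "supp (\<lambda>p. \<ominus>\<^bsub>K\<^esub> f p) \<subseteq> supp f" by auto
  have "(\<lambda>p. \<ominus>\<^bsub>K\<^esub> f p) \<in> carrier F"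
    using f s finite_subset[OF s] unfolding F_carrier by blast
  then show "\<exists>g\<in>carrier F. g \<oplus>\<^bsub>F\<^esub> f = \<zero>\<^bsub>F\<^esub>"
    using f by (intro bexI[of _ "\<lambda>p. \<ominus>\<^bsub>K\<^esub> f p"]) (auto simp: F_simps K.l_neg)
qed (auto simp: F_add_closed F_zero_closed, (auto simp: F_simps K.a_ac)?)

lemma F_module: "module K F"
  by (rule moduleI)
    (auto simp: F_abelian K.is_cring F_smult_closed, (auto simp: F_simps K.l_distr K.r_distr K.m_assoc))

sublocale Fm: module K F by (rule F_module)

lemma single_scaled: "k \<in> carrier K \<Longrightarrow> k \<odot>\<^bsub>F\<^esub> single K p = (\<lambda>q. if q = p then k else \<zero>\<^bsub>K\<^esub>)"
  by (auto simp: F_simps single_def)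

lemma F_induct [consumes 1, case_names zero add]:
  assumes f: "f \<in> carrier F"
    and z: "P \<zero>\<^bsub>F\<^esub>"
    and s: "\<And>k p g. \<lbrakk>k \<in> carrier K; p \<in> carrier G; g \<in> carrier F; P g\<rbrakk> \<Longrightarrow>
      P ((k \<odot>\<^bsub>F\<^esub> single K p) \<oplus>\<^bsub>F\<^esub> g)"
  shows "P f"
proof -
  have "finite S \<Longrightarrow> f \<in> carrier F \<Longrightarrow> supp f \<subseteq> S \<Longrightarrow> P f" for S f
  proof (induction S arbitrary: f rule: finite_induct)
    case empty
    then have "f = \<zero>\<^bsub>F\<^esub>" by (auto simp: F_simps)
    then show ?case using z by simp
  next
    case (insert p S)
    show ?case
    proof (cases "f p = \<zero>\<^bsub>K\<^esub>")
      case True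
      then show ?thesis using insert by blast
    next
      case False
      let ?g = "f(p := \<zero>\<^bsub>K\<^esub>)"
      have sg: "supp ?g \<subseteq> supp f" by auto
      have g: "?g \<in> carrier F"
        using insert.prems(1) sg finite_subset[OF sg] unfolding F_carrier by auto
      have p: "p \<in> carrier G" using False insert.prems(1) unfolding F_carrier by auto
      have pk: "f p \<in> carrier K" using insert.prems(1) by simp
      have "supp ?g \<subseteq> S" using insert.prems(2) by auto
      then have "P ?g" using insert.IH g by blast
      from s[OF pk p g this]
      have "P ((f p \<odot>\<^bsub>F\<^esub> single K p) \<oplus>\<^bsub>F\<^esub> ?g)" .
      moreover have "(f p \<odot>\<^bsub>F\<^esub> single K p) \<oplus>\<^bsub>F\<^esub> ?g = f"
        unfolding single_scaled[OF pk] using insert.prems(1) pk by (auto simp: F_simps)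
      ultimately show ?thesis by simp
    qed
  qed
  then show ?thesis using f unfolding F_carrier by blast
qed

lemma mult_on:
  assumes f: "f \<in> carrier F" and g: "g \<in> carrier F"
    and S: "finite S" "supp f \<subseteq> S" and T: "finite T" "supp g \<subseteq> T"
  shows "(f \<otimes>\<^bsub>F\<^esub> g) p = (\<Oplus>\<^bsub>K\<^esub>x \<in> S \<times> T. if fst x \<otimes>\<^bsub>G\<^esub> snd x = p
    then f (fst x) \<otimes>\<^bsub>K\<^esub> g (snd x) else \<zero>\<^bsub>K\<^esub>)"
proof -
  have "(f \<otimes>\<^bsub>F\<^esub> g) p = (\<Oplus>\<^bsub>K\<^esub>x \<in> {(q, r). f q \<noteq> \<zero>\<^bsub>K\<^esub> \<and> g r \<noteq> \<zero>\<^bsub>K\<^esub> \<and> q \<otimes>\<^bsub>G\<^esub> r = p}.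
       f (fst x) \<otimes>\<^bsub>K\<^esub> g (snd x))"
    by (simp add: monoid_algebra_def)
  also have "\<dots> = (\<Oplus>\<^bsub>K\<^esub>x \<in> S \<times> T. if fst x \<otimes>\<^bsub>G\<^esub> snd x = p
    then f (fst x) \<otimes>\<^bsub>K\<^esub> g (snd x) else \<zero>\<^bsub>K\<^esub>)"
    by (rule K.add.finprod_mono_neutral_cong_left) (use S T f g in \<open>auto\<close>)
  finally show ?thesis .
qed

lemma supp_fin: "f \<in> carrier F \<Longrightarrow> finite (supp f)"
  by (simp add: F_carrier)

lemma mult_closed: assumes f: "f \<in> carrier F" and g: "g \<in> carrier F"
  shows "f \<otimes>\<^bsub>F\<^esub> g \<in> carrier F"
proof -
  let ?m = "\<lambda>(q, r). q \<otimes>\<^bsub>G\<^esub> r"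
  note e = mult_on[OF f g supp_fin[OF f] order_refl supp_fin[OF g] order_refl]
  have 0: "(f \<otimes>\<^bsub>F\<^esub> g) p = \<zero>\<^bsub>K\<^esub>" if "p \<notin> ?m ` (supp f \<times> supp g)" for p
    unfolding e by (rule K.add.finprod_one_eqI) (use that in \<open>force\<close>)
  have c: "(f \<otimes>\<^bsub>F\<^esub> g) p \<in> carrier K" for p
    unfolding e by (rule K.add.finprod_closed) (use f g in auto)
  have s: "supp (f \<otimes>\<^bsub>F\<^esub> g) \<subseteq> ?m ` (supp f \<times> supp g)" using 0 by blast
  moreover have "finite (?m ` (supp f \<times> supp g))" using f g by (simp add: supp_fin)
  moreover have "?m ` (supp f \<times> supp g) \<subseteq> carrier G"
    using f g unfolding F_carrier by auto
  ultimately show ?thesis unfolding F_carrier using c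
    by (metis (no_types, lifting) finite_subset subset_trans)
qed

lemma mult_add_left: assumes f: "f \<in> carrier F" "f' \<in> carrier F" and g: "g \<in> carrier F"
  shows "(f \<oplus>\<^bsub>F\<^esub> f') \<otimes>\<^bsub>F\<^esub> g = (f \<otimes>\<^bsub>F\<^esub> g) \<oplus>\<^bsub>F\<^esub> (f' \<otimes>\<^bsub>F\<^esub> g)"
proof
  fix p
  let ?S = "supp f \<union> supp f'"
  have S: "finite ?S" "supp (f \<oplus>\<^bsub>F\<^esub> f') \<subseteq> ?S" "supp f \<subseteq> ?S" "supp f' \<subseteq> ?S"
    using f by (auto simp: supp_fin F_simps)
  note T = supp_fin[OF g] order_refl
  let ?h = "\<lambda>f x. if fst x \<otimes>\<^bsub>G\<^esub> snd x = p then f (fst x) \<otimes>\<^bsub>K\<^esub> g (snd x) else \<zero>\<^bsub>K\<^esub>"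
  have c: "?h f \<in> ?S \<times> supp g \<rightarrow> carrier K" "?h f' \<in> ?S \<times> supp g \<rightarrow> carrier K" using f g by auto
  show "((f \<oplus>\<^bsub>F\<^esub> f') \<otimes>\<^bsub>F\<^esub> g) p = ((f \<otimes>\<^bsub>F\<^esub> g) \<oplus>\<^bsub>F\<^esub> (f' \<otimes>\<^bsub>F\<^esub> g)) p"
    unfolding mult_on[OF F_add_closed[OF f] g S(1,2) T] F_simps(2)[of "f \<otimes>\<^bsub>F\<^esub> g"]
      mult_on[OF f(1) g S(1,3) T] mult_on[OF f(2) g S(1,4) T]
      K.add.finprod_multf[OF c, symmetric]
    by (rule K.add.finprod_cong') (use f g in \<open>auto simp: F_simps K.l_distr\<close>)
qed

lemma mult_smult_left: assumes k: "k \<in> carrier K" and f: "f \<in> carrier F" and g: "g \<in> carrier F"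
  shows "(k \<odot>\<^bsub>F\<^esub> f) \<otimes>\<^bsub>F\<^esub> g = k \<odot>\<^bsub>F\<^esub> (f \<otimes>\<^bsub>F\<^esub> g)"
proof
  fix p
  let ?S = "supp f"
  have S: "finite ?S" "supp (k \<odot>\<^bsub>F\<^esub> f) \<subseteq> ?S" "supp f \<subseteq> ?S"
    using f k by (auto simp: supp_fin F_simps)
  note T = supp_fin[OF g] order_refl
  show "((k \<odot>\<^bsub>F\<^esub> f) \<otimes>\<^bsub>F\<^esub> g) p = (k \<odot>\<^bsub>F\<^esub> (f \<otimes>\<^bsub>F\<^esub> g)) p"
    unfolding mult_on[OF F_smult_closed[OF k f] g S(1,2) T] F_simps(3)[of k "f \<otimes>\<^bsub>F\<^esub> g"]
      mult_on[OF f g S(1,3) T]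
    by (subst K.finsum_rdistr)
      (use f g k S supp_fin[OF g] in \<open>auto intro!: K.add.finprod_cong' simp: F_simps K.m_assoc\<close>)
qed

lemma mult_comm: assumes f: "f \<in> carrier F" and g: "g \<in> carrier F"
  shows "f \<otimes>\<^bsub>F\<^esub> g = g \<otimes>\<^bsub>F\<^esub> f"
proof
  fix p
  let ?h = "\<lambda>x. if fst x \<otimes>\<^bsub>G\<^esub> snd x = p then f (fst x) \<otimes>\<^bsub>K\<^esub> g (snd x) else \<zero>\<^bsub>K\<^esub>"
  have G: "supp f \<subseteq> carrier G" "supp g \<subseteq> carrier G" using f g by (auto simp: F_carrier)
  have im: "supp f \<times> supp g = prod.swap ` (supp g \<times> supp f)" by force
  have "(f \<otimes>\<^bsub>F\<^esub> g) p = (\<Oplus>\<^bsub>K\<^esub>x \<in> prod.swap ` (supp g \<times> supp f). ?h x)"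
    unfolding mult_on[OF f g supp_fin[OF f] order_refl supp_fin[OF g] order_refl] im by simp
  also have "\<dots> = (\<Oplus>\<^bsub>K\<^esub>x \<in> supp g \<times> supp f. ?h (prod.swap x))"
    by (rule K.add.finprod_reindex) (use f g in auto)
  also have "\<dots> = (g \<otimes>\<^bsub>F\<^esub> f) p"
    unfolding mult_on[OF g f supp_fin[OF g] order_refl supp_fin[OF f] order_refl]
    by (rule K.add.finprod_cong') (use f g G in \<open>auto simp: K.m_comm G.m_comm subset_iff\<close>)
  finally show "(f \<otimes>\<^bsub>F\<^esub> g) p = (g \<otimes>\<^bsub>F\<^esub> f) p" .
qed

lemma mult_single: assumes "p \<in> carrier G" "q \<in> carrier G"
  shows "single K p \<otimes>\<^bsub>F\<^esub> single K q = single K (p \<otimes>\<^bsub>G\<^esub> q)"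
proof
  fix r
  have s: "finite {t}" "supp (single K t) \<subseteq> {t}" for t :: 'g by (auto simp: single_def)
  show "(single K p \<otimes>\<^bsub>F\<^esub> single K q) r = single K (p \<otimes>\<^bsub>G\<^esub> q) r"
    unfolding mult_on[OF single_closed[OF assms(1)] single_closed[OF assms(2)] s s]
    by (simp add: single_def Pi_def)
qed

lemma mult_add_right: assumes "f \<in> carrier F" "g \<in> carrier F" "g' \<in> carrier F"
  shows "f \<otimes>\<^bsub>F\<^esub> (g \<oplus>\<^bsub>F\<^esub> g') = (f \<otimes>\<^bsub>F\<^esub> g) \<oplus>\<^bsub>F\<^esub> (f \<otimes>\<^bsub>F\<^esub> g')"
  using assms by (metis mult_comm mult_add_left F_add_closed)

lemma mult_smult_right: assumes "k \<in> carrier K" "f \<in> carrier F" "g \<in> carrier F"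
  shows "f \<otimes>\<^bsub>F\<^esub> (k \<odot>\<^bsub>F\<^esub> g) = k \<odot>\<^bsub>F\<^esub> (f \<otimes>\<^bsub>F\<^esub> g)"
  using assms by (metis mult_comm mult_smult_left F_smult_closed)

lemma mult_zero_left: "f \<in> carrier F \<Longrightarrow> \<zero>\<^bsub>F\<^esub> \<otimes>\<^bsub>F\<^esub> f = \<zero>\<^bsub>F\<^esub>"
  using mult_smult_left[of "\<zero>\<^bsub>K\<^esub>" "\<zero>\<^bsub>F\<^esub>" f] by (simp add: mult_closed)

lemma mult_zero_right: "f \<in> carrier F \<Longrightarrow> f \<otimes>\<^bsub>F\<^esub> \<zero>\<^bsub>F\<^esub> = \<zero>\<^bsub>F\<^esub>"
  using mult_smult_right[of "\<zero>\<^bsub>K\<^esub>" f "\<zero>\<^bsub>F\<^esub>"] by (simp add: mult_closed)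

lemmas F_mult = mult_closed mult_add_left mult_add_right mult_smult_left mult_smult_right
  mult_zero_left mult_zero_right single_closed

lemma mult_assoc: assumes f: "f \<in> carrier F" and g: "g \<in> carrier F" and h: "h \<in> carrier F"
  shows "(f \<otimes>\<^bsub>F\<^esub> g) \<otimes>\<^bsub>F\<^esub> h = f \<otimes>\<^bsub>F\<^esub> (g \<otimes>\<^bsub>F\<^esub> h)"
proof -
  have 1: "(single K p \<otimes>\<^bsub>F\<^esub> single K q) \<otimes>\<^bsub>F\<^esub> h = single K p \<otimes>\<^bsub>F\<^esub> (single K q \<otimes>\<^bsub>F\<^esub> h)"
    if pq: "p \<in> carrier G" "q \<in> carrier G" for p q
    using h by (induction rule: F_induct) (use pq in \<open>simp_all add: F_mult mult_single G.m_assoc\<close>)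
  have 2: "(single K p \<otimes>\<^bsub>F\<^esub> g) \<otimes>\<^bsub>F\<^esub> h = single K p \<otimes>\<^bsub>F\<^esub> (g \<otimes>\<^bsub>F\<^esub> h)"
    if p: "p \<in> carrier G" for p
    using g by (induction rule: F_induct) (use p h in \<open>simp_all add: F_mult 1\<close>)
  show ?thesis
    using f by (induction rule: F_induct) (use g h in \<open>simp_all add: F_mult 2\<close>)
qed

lemma mult_one: assumes f: "f \<in> carrier F" shows "\<one>\<^bsub>F\<^esub> \<otimes>\<^bsub>F\<^esub> f = f"
  using f by (induction rule: F_induct) (simp_all add: F_mult F_simps(4) mult_single)

lemma one_closed: "\<one>\<^bsub>F\<^esub> \<in> carrier F"
  by (simp add: F_simps(4) single_closed)

lemma F_cring: "cring F"
proof (rule cringI)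
  show "comm_monoid F"
    by (rule comm_monoidI) (auto simp: mult_closed mult_assoc mult_one one_closed intro: mult_comm)
qed (auto simp: F_abelian mult_add_left)

lemma F_algebra: "algebra K F"
  by (rule algebraI)
    (auto simp: K.is_cring F_cring mult_smult_left Fm.smult_l_distr Fm.smult_r_distr Fm.smult_assoc1)

end

lemma quotient_algebra_algebra:
  assumes F: "algebra K F" and I: "ideal I F"
    and sm: "\<And>k x. \<lbrakk>k \<in> carrier K; x \<in> I\<rbrakk> \<Longrightarrow> k \<odot>\<^bsub>F\<^esub> x \<in> I"
  shows "algebra K (quotient_algebra F I)"
    and "\<lbrakk>k \<in> carrier K; x \<in> carrier F\<rbrakk> \<Longrightarrow>
      k \<odot>\<^bsub>quotient_algebra F I\<^esub> (I +>\<^bsub>F\<^esub> x) = I +>\<^bsub>F\<^esub> (k \<odot>\<^bsub>F\<^esub> x)"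
proof -
  interpret F: algebra K F by fact
  interpret I: ideal I F by fact
  interpret Q: cring "F Quot I" by (rule I.quotient_is_cring[OF F.M_cring])
  let ?Q = "quotient_algebra F I"
  have sc: "k \<odot>\<^bsub>?Q\<^esub> (I +>\<^bsub>F\<^esub> x) = I +>\<^bsub>F\<^esub> (k \<odot>\<^bsub>F\<^esub> x)" if k: "k \<in> carrier K" and x: "x \<in> carrier F" for k x
  proof -
    have "I +>\<^bsub>F\<^esub> (k \<odot>\<^bsub>F\<^esub> y) = I +>\<^bsub>F\<^esub> (k \<odot>\<^bsub>F\<^esub> x)" if y: "y \<in> I +>\<^bsub>F\<^esub> x" for y
    proof -
      obtain i where i: "i \<in> I" "y = i \<oplus>\<^bsub>F\<^esub> x" using y by (auto simp: a_r_coset_def')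
      have "k \<odot>\<^bsub>F\<^esub> y = k \<odot>\<^bsub>F\<^esub> i \<oplus>\<^bsub>F\<^esub> k \<odot>\<^bsub>F\<^esub> x"
        using i k x I.a_Hcarr by (simp add: F.smult_r_distr)
      then have "k \<odot>\<^bsub>F\<^esub> y \<in> I +>\<^bsub>F\<^esub> (k \<odot>\<^bsub>F\<^esub> x)" using sm[OF k i(1)] by (auto simp: a_r_coset_def')
      then show ?thesis
        using F.M.a_repr_independence[OF _ F.smult_closed[OF k x] I.a_subgroup] by simp
    qed
    moreover have "x \<in> I +>\<^bsub>F\<^esub> x" using x by (rule I.a_rcos_self)
    ultimately have "(\<Union>y\<in>I +>\<^bsub>F\<^esub> x. I +>\<^bsub>F\<^esub> (k \<odot>\<^bsub>F\<^esub> y)) = I +>\<^bsub>F\<^esub> (k \<odot>\<^bsub>F\<^esub> x)"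
      by (metis (no_types, lifting) SUP_eq_const empty_iff)
    then show ?thesis by (simp add: quotient_algebra_def)
  qed
  show "\<lbrakk>k \<in> carrier K; x \<in> carrier F\<rbrakk> \<Longrightarrow>
      k \<odot>\<^bsub>?Q\<^esub> (I +>\<^bsub>F\<^esub> x) = I +>\<^bsub>F\<^esub> (k \<odot>\<^bsub>F\<^esub> x)" by (rule sc)
  have qs: "carrier ?Q = carrier (F Quot I)" "mult ?Q = mult (F Quot I)" "one ?Q = one (F Quot I)"
    "zero ?Q = zero (F Quot I)" "add ?Q = add (F Quot I)"
    by (simp_all add: quotient_algebra_def)
  have ab: "abelian_group ?Q"
  proof (rule abelian_groupI)
    show "\<exists>y\<in>carrier ?Q. y \<oplus>\<^bsub>?Q\<^esub> x = \<zero>\<^bsub>?Q\<^esub>" if "x \<in> carrier ?Q" for x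
      using that Q.l_neg Q.a_inv_closed unfolding qs by blast
  qed (simp_all add: qs Q.a_ac)
  have cr: "cring ?Q"
  proof (rule cringI)
    show "abelian_group ?Q" by (rule ab)
    show "comm_monoid ?Q"
      by (rule comm_monoidI) (simp_all add: qs Q.m_ac)
  qed (auto simp: qs Q.l_distr)
  have ex: "\<exists>x\<in>carrier F. X = I +>\<^bsub>F\<^esub> x" if "X \<in> carrier ?Q" for X
    using that by (auto simp: qs FactRing_def A_RCOSETS_def')
  have cl: "I +>\<^bsub>F\<^esub> x \<in> carrier ?Q" if "x \<in> carrier F" for x
    using that by (auto simp: qs FactRing_def A_RCOSETS_def')
  have ad: "(I +>\<^bsub>F\<^esub> x) \<oplus>\<^bsub>?Q\<^esub> (I +>\<^bsub>F\<^esub> y) = I +>\<^bsub>F\<^esub> (x \<oplus>\<^bsub>F\<^esub> y)"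
    if "x \<in> carrier F" "y \<in> carrier F" for x y
    using that by (simp add: qs FactRing_def I.a_rcos_sum)
  have mu: "(I +>\<^bsub>F\<^esub> x) \<otimes>\<^bsub>?Q\<^esub> (I +>\<^bsub>F\<^esub> y) = I +>\<^bsub>F\<^esub> (x \<otimes>\<^bsub>F\<^esub> y)"
    if "x \<in> carrier F" "y \<in> carrier F" for x y
    using that by (simp add: qs FactRing_def I.rcoset_mult_add)
  show "algebra K ?Q"
  proof (rule algebraI)
    show "cring K" by (rule F.R_cring)
    show "cring ?Q" by (rule cr)
    note fs = sc cl ad mu F.smult_l_distr F.smult_r_distr F.smult_assoc1 F.smult_assoc2
    show "\<one>\<^bsub>K\<^esub> \<odot>\<^bsub>?Q\<^esub> X = X" if "X \<in> carrier ?Q" for X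
      using ex[OF that] by (auto simp: fs)
    fix a X assume a: "a \<in> carrier K" and "X \<in> carrier ?Q"
    then obtain x where x: "x \<in> carrier F" "X = I +>\<^bsub>F\<^esub> x" using ex by metis
    show "a \<odot>\<^bsub>?Q\<^esub> X \<in> carrier ?Q" using a x by (simp add: fs)
    show "(a \<oplus>\<^bsub>K\<^esub> b) \<odot>\<^bsub>?Q\<^esub> X = a \<odot>\<^bsub>?Q\<^esub> X \<oplus>\<^bsub>?Q\<^esub> b \<odot>\<^bsub>?Q\<^esub> X" if "b \<in> carrier K" for b
      using a x that by (simp add: fs)
    show "(a \<otimes>\<^bsub>K\<^esub> b) \<odot>\<^bsub>?Q\<^esub> X = a \<odot>\<^bsub>?Q\<^esub> (b \<odot>\<^bsub>?Q\<^esub> X)" if "b \<in> carrier K" for b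
      using a x that by (simp add: fs)
    fix Y assume "Y \<in> carrier ?Q"
    then obtain y where y: "y \<in> carrier F" "Y = I +>\<^bsub>F\<^esub> y" using ex by metis
    show "a \<odot>\<^bsub>?Q\<^esub> (X \<oplus>\<^bsub>?Q\<^esub> Y) = a \<odot>\<^bsub>?Q\<^esub> X \<oplus>\<^bsub>?Q\<^esub> a \<odot>\<^bsub>?Q\<^esub> Y" using a x y by (simp add: fs)
    show "(a \<odot>\<^bsub>?Q\<^esub> X) \<otimes>\<^bsub>?Q\<^esub> Y = a \<odot>\<^bsub>?Q\<^esub> (X \<otimes>\<^bsub>?Q\<^esub> Y)" using a x y by (simp add: fs)
  qed
qed

locale tensor = A: algebra K A + B: algebra K B
  for K :: "('k, 'm) ring_scheme" (structure)
    and A :: "('k, 'a, 'n) module_scheme" (structure)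
    and B :: "('k, 'b, 'l) module_scheme" (structure)
begin

sublocale monoid_alg K "A \<times>\<times> B"
proof -
  have "comm_monoid (A \<times>\<times> B)"
    by (rule comm_monoidI) (auto simp: A.m_assoc B.m_assoc intro: A.m_comm B.m_comm)
  then show "monoid_alg K (A \<times>\<times> B)" unfolding monoid_alg_def using A.R_cring by simp
qed

abbreviation "J \<equiv> tensor_kernel K A B"
abbreviation "T \<equiv> tensor_product K A B"
abbreviation pt (infixl "\<otimes>t" 75) where "a \<otimes>t b \<equiv> pure_tensor K A B a b"

sublocale F: algebra K F by (rule F_algebra)

lemma rels_cases:
  assumes "x \<in> tensor_relations K A B"
  obtains
    (1) a a' b where "x = single K (a \<oplus>\<^bsub>A\<^esub> a', b) \<ominus>\<^bsub>F\<^esub> (single K (a, b) \<oplus>\<^bsub>F\<^esub> single K (a', b))"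
      "a \<in> carrier A" "a' \<in> carrier A" "b \<in> carrier B"
  | (2) a b b' where "x = single K (a, b \<oplus>\<^bsub>B\<^esub> b') \<ominus>\<^bsub>F\<^esub> (single K (a, b) \<oplus>\<^bsub>F\<^esub> single K (a, b'))"
      "a \<in> carrier A" "b \<in> carrier B" "b' \<in> carrier B"
  | (3) k a b where "x = single K (k \<odot>\<^bsub>A\<^esub> a, b) \<ominus>\<^bsub>F\<^esub> k \<odot>\<^bsub>F\<^esub> single K (a, b)"
      "k \<in> carrier K" "a \<in> carrier A" "b \<in> carrier B"
  | (4) k a b where "x = single K (a, k \<odot>\<^bsub>B\<^esub> b) \<ominus>\<^bsub>F\<^esub> k \<odot>\<^bsub>F\<^esub> single K (a, b)"
      "k \<in> carrier K" "a \<in> carrier A" "b \<in> carrier B"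
  using assms unfolding tensor_relations_def Let_def by blast

lemma relsI:
  "\<lbrakk>a \<in> carrier A; a' \<in> carrier A; b \<in> carrier B\<rbrakk> \<Longrightarrow>
    single K (a \<oplus>\<^bsub>A\<^esub> a', b) \<ominus>\<^bsub>F\<^esub> (single K (a, b) \<oplus>\<^bsub>F\<^esub> single K (a', b)) \<in> tensor_relations K A B"
  "\<lbrakk>a \<in> carrier A; b \<in> carrier B; b' \<in> carrier B\<rbrakk> \<Longrightarrow>
    single K (a, b \<oplus>\<^bsub>B\<^esub> b') \<ominus>\<^bsub>F\<^esub> (single K (a, b) \<oplus>\<^bsub>F\<^esub> single K (a, b')) \<in> tensor_relations K A B"
  "\<lbrakk>k \<in> carrier K; a \<in> carrier A; b \<in> carrier B\<rbrakk> \<Longrightarrow>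
    single K (k \<odot>\<^bsub>A\<^esub> a, b) \<ominus>\<^bsub>F\<^esub> k \<odot>\<^bsub>F\<^esub> single K (a, b) \<in> tensor_relations K A B"
  "\<lbrakk>k \<in> carrier K; a \<in> carrier A; b \<in> carrier B\<rbrakk> \<Longrightarrow>
    single K (a, k \<odot>\<^bsub>B\<^esub> b) \<ominus>\<^bsub>F\<^esub> k \<odot>\<^bsub>F\<^esub> single K (a, b) \<in> tensor_relations K A B"
     apply (unfold tensor_relations_def Let_def)
     apply (rule UnI1, rule UnI1, rule UnI1, blast)
    apply (rule UnI1, rule UnI1, rule UnI2, blast)
   apply (rule UnI1, rule UnI2, blast)
  apply (rule UnI2, blast)
  done

lemma rels_sub: "tensor_relations K A B \<subseteq> carrier F"
proof
  fix x assume "x \<in> tensor_relations K A B"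
  then show "x \<in> carrier F" by (cases rule: rels_cases) (simp_all add: single_closed)
qed

lemma J_submodule: "submodule J K F"
proof -
  have F: "submodule (carrier F) K F" by (rule Fm.carrier_is_submodule)
  have mem: "x \<in> J \<longleftrightarrow> (\<forall>H. submodule H K F \<and> tensor_relations K A B \<subseteq> H \<longrightarrow> x \<in> H)" for x
    by (auto simp: tensor_kernel_def module_span_def)
  have sub: "J \<subseteq> carrier F" using mem F rels_sub by blast
  show ?thesis
    apply (rule Fm.submoduleI)
        apply (rule sub)
       apply (unfold mem)
       apply (metis submodule.axioms(1) subgroup.one_closed monoid.select_convs(2))
      apply (metis Fm.submoduleE(3))
     apply (metis Fm.submoduleE(5))
    apply (metis Fm.submoduleE(4))
    done
qed

lemma J_least: "\<lbrakk>submodule H K F; tensor_relations K A B \<subseteq> H\<rbrakk> \<Longrightarrow> J \<subseteq> H"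
  by (auto simp: tensor_kernel_def module_span_def)

lemma J_rels: "tensor_relations K A B \<subseteq> J"
  by (auto simp: tensor_kernel_def module_span_def)

lemma mult_minus_right: "\<lbrakk>f \<in> carrier F; g \<in> carrier F; h \<in> carrier F\<rbrakk> \<Longrightarrow>
  f \<otimes>\<^bsub>F\<^esub> (g \<ominus>\<^bsub>F\<^esub> h) = (f \<otimes>\<^bsub>F\<^esub> g) \<ominus>\<^bsub>F\<^esub> (f \<otimes>\<^bsub>F\<^esub> h)"
  by (simp add: a_minus_def F.r_distr F.r_minus)

lemma single_rel:
  assumes p: "p \<in> carrier (A \<times>\<times> B)" and x: "x \<in> tensor_relations K A B"
  shows "single K p \<otimes>\<^bsub>F\<^esub> x \<in> tensor_relations K A B"
proof -
  obtain u v where uv: "p = (u, v)" "u \<in> carrier A" "v \<in> carrier B" using p by auto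
  note s = mult_minus_right mult_add_right mult_smult_right mult_single single_closed
    A.r_distr B.r_distr
  have c1: "u \<otimes>\<^bsub>A\<^esub> (k \<odot>\<^bsub>A\<^esub> a) = k \<odot>\<^bsub>A\<^esub> (u \<otimes>\<^bsub>A\<^esub> a)" if "k \<in> carrier K" "a \<in> carrier A" for k a
    using that uv by (metis A.smult_assoc2 A.m_comm A.smult_closed)
  have c2: "v \<otimes>\<^bsub>B\<^esub> (k \<odot>\<^bsub>B\<^esub> a) = k \<odot>\<^bsub>B\<^esub> (v \<otimes>\<^bsub>B\<^esub> a)" if "k \<in> carrier K" "a \<in> carrier B" for k a
    using that uv by (metis B.smult_assoc2 B.m_comm B.smult_closed)
  from x show ?thesis
  proof (cases rule: rels_cases)
    case (1 a a' b)
    then have "single K p \<otimes>\<^bsub>F\<^esub> x = single K (u \<otimes>\<^bsub>A\<^esub> a \<oplus>\<^bsub>A\<^esub> u \<otimes>\<^bsub>A\<^esub> a', v \<otimes>\<^bsub>B\<^esub> b) \<ominus>\<^bsub>F\<^esub>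
      (single K (u \<otimes>\<^bsub>A\<^esub> a, v \<otimes>\<^bsub>B\<^esub> b) \<oplus>\<^bsub>F\<^esub> single K (u \<otimes>\<^bsub>A\<^esub> a', v \<otimes>\<^bsub>B\<^esub> b))"
      using uv by (simp add: s)
    then show ?thesis using relsI(1) 1 uv by simp
  next
    case (2 a b b')
    then have "single K p \<otimes>\<^bsub>F\<^esub> x = single K (u \<otimes>\<^bsub>A\<^esub> a, v \<otimes>\<^bsub>B\<^esub> b \<oplus>\<^bsub>B\<^esub> v \<otimes>\<^bsub>B\<^esub> b') \<ominus>\<^bsub>F\<^esub>
      (single K (u \<otimes>\<^bsub>A\<^esub> a, v \<otimes>\<^bsub>B\<^esub> b) \<oplus>\<^bsub>F\<^esub> single K (u \<otimes>\<^bsub>A\<^esub> a, v \<otimes>\<^bsub>B\<^esub> b'))"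
      using uv by (simp add: s)
    then show ?thesis using relsI(2) 2 uv by simp
  next
    case (3 k a b)
    then have "single K p \<otimes>\<^bsub>F\<^esub> x = single K (k \<odot>\<^bsub>A\<^esub> (u \<otimes>\<^bsub>A\<^esub> a), v \<otimes>\<^bsub>B\<^esub> b) \<ominus>\<^bsub>F\<^esub>
      k \<odot>\<^bsub>F\<^esub> single K (u \<otimes>\<^bsub>A\<^esub> a, v \<otimes>\<^bsub>B\<^esub> b)"
      using uv by (simp add: s c1)
    then show ?thesis using relsI(3) 3 uv by simp
  next
    case (4 k a b)
    then have "single K p \<otimes>\<^bsub>F\<^esub> x = single K (u \<otimes>\<^bsub>A\<^esub> a, k \<odot>\<^bsub>B\<^esub> (v \<otimes>\<^bsub>B\<^esub> b)) \<ominus>\<^bsub>F\<^esub>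
      k \<odot>\<^bsub>F\<^esub> single K (u \<otimes>\<^bsub>A\<^esub> a, v \<otimes>\<^bsub>B\<^esub> b)"
      using uv by (simp add: s c2)
    then show ?thesis using relsI(4) 4 uv by simp
  qed
qed

lemmas JE = Fm.submoduleE[OF J_submodule]

lemma J_zero: "\<zero>\<^bsub>F\<^esub> \<in> J"
  using subgroup.one_closed[OF submodule.axioms(1)[OF J_submodule]] by simp

lemma J_mult_single:
  assumes p: "p \<in> carrier (A \<times>\<times> B)" and x: "x \<in> J"
  shows "single K p \<otimes>\<^bsub>F\<^esub> x \<in> J"
proof -
  let ?H = "{y \<in> carrier F. single K p \<otimes>\<^bsub>F\<^esub> y \<in> J}"
  have "submodule ?H K F"
    by (rule Fm.submoduleI)
      (use p JE J_zero in \<open>auto simp: F_mult F.r_minus\<close>)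
  then have "J \<subseteq> ?H"
    by (rule J_least) (use rels_sub J_rels single_rel[OF p] in blast)
  then show ?thesis using x by blast
qed

lemma J_ideal: "ideal J F"
proof -
  have l: "f \<otimes>\<^bsub>F\<^esub> x \<in> J" if "f \<in> carrier F" "x \<in> J" for f x
    using that(1)
  proof (induction rule: F_induct)
    case zero
    then show ?case using that JE(1) J_zero by (auto simp: mult_zero_left subset_iff)
  next
    case (add k p g)
    have x: "x \<in> carrier F" using that JE(1) by blast
    then show ?case
      using add JE(4,5) J_mult_single[OF add(2) that(2)]
      by (simp add: mult_add_left mult_smult_left single_closed)
  qed
  have x: "x \<in> carrier F" if "x \<in> J" for x using that JE(1) by blast
  have r: "x \<otimes>\<^bsub>F\<^esub> f \<in> J" if "f \<in> carrier F" "x \<in> J" for f x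
    using l[OF that] mult_comm[OF that(1) x[OF that(2)]] by simp
  show ?thesis
    using l r submodule.axioms(1)[OF J_submodule] cring.axioms(1)[OF F_cring]
    by (intro idealI) simp_all
qed

lemma tensor_algebra: "algebra K T"
  unfolding tensor_product_def by (rule quotient_algebra_algebra(1)[OF F_algebra J_ideal JE(4)])

sublocale T: algebra K T by (rule tensor_algebra)

sublocale J: ideal J F by (rule J_ideal)

lemma T_carrier: "carrier T = (\<lambda>f. J +>\<^bsub>F\<^esub> f) ` carrier F"
  by (auto simp: tensor_product_def quotient_algebra_def FactRing_def A_RCOSETS_def')

lemma T_add: "\<lbrakk>x \<in> carrier F; y \<in> carrier F\<rbrakk> \<Longrightarrow>
    (J +>\<^bsub>F\<^esub> x) \<oplus>\<^bsub>T\<^esub> (J +>\<^bsub>F\<^esub> y) = J +>\<^bsub>F\<^esub> (x \<oplus>\<^bsub>F\<^esub> y)"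
  by (simp add: tensor_product_def quotient_algebra_def FactRing_def J.a_rcos_sum)

lemma T_mult: "\<lbrakk>x \<in> carrier F; y \<in> carrier F\<rbrakk> \<Longrightarrow>
    (J +>\<^bsub>F\<^esub> x) \<otimes>\<^bsub>T\<^esub> (J +>\<^bsub>F\<^esub> y) = J +>\<^bsub>F\<^esub> (x \<otimes>\<^bsub>F\<^esub> y)"
  by (simp add: tensor_product_def quotient_algebra_def FactRing_def J.rcoset_mult_add)

lemma T_smult: "\<lbrakk>k \<in> carrier K; x \<in> carrier F\<rbrakk> \<Longrightarrow>
    k \<odot>\<^bsub>T\<^esub> (J +>\<^bsub>F\<^esub> x) = J +>\<^bsub>F\<^esub> (k \<odot>\<^bsub>F\<^esub> x)"
  unfolding tensor_product_def by (rule quotient_algebra_algebra(2)[OF F_algebra J_ideal JE(4)])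

lemma T_zero: "\<zero>\<^bsub>T\<^esub> = J"
  by (simp add: tensor_product_def quotient_algebra_def FactRing_def)

lemma T_one: "\<one>\<^bsub>T\<^esub> = \<one>\<^bsub>A\<^esub> \<otimes>t \<one>\<^bsub>B\<^esub>"
  by (simp add: tensor_product_def quotient_algebra_def FactRing_def pure_tensor_def F_simps)

lemma coset_eq: "\<lbrakk>x \<in> carrier F; y \<in> carrier F; x \<ominus>\<^bsub>F\<^esub> y \<in> J\<rbrakk> \<Longrightarrow> J +>\<^bsub>F\<^esub> x = J +>\<^bsub>F\<^esub> y"
  by (metis F_cring J_ideal cring.axioms(1) ring.quotient_eq_iff_same_a_r_cos)

lemma pt_closed: "\<lbrakk>a \<in> carrier A; b \<in> carrier B\<rbrakk> \<Longrightarrow> a \<otimes>t b \<in> carrier T"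
  by (auto simp: T_carrier pure_tensor_def intro!: imageI single_closed)

lemma pt_add_left: assumes "a \<in> carrier A" "a' \<in> carrier A" "b \<in> carrier B"
  shows "(a \<oplus>\<^bsub>A\<^esub> a') \<otimes>t b = a \<otimes>t b \<oplus>\<^bsub>T\<^esub> a' \<otimes>t b"
proof -
  have "single K (a \<oplus>\<^bsub>A\<^esub> a', b) \<ominus>\<^bsub>F\<^esub> (single K (a, b) \<oplus>\<^bsub>F\<^esub> single K (a', b)) \<in> J"
    by (intro subsetD[OF J_rels] relsI assms)
  then show ?thesis unfolding pure_tensor_def using assms
    by (simp add: T_add coset_eq single_closed)
qed

lemma pt_add_right: assumes "a \<in> carrier A" "b \<in> carrier B" "b' \<in> carrier B"
  shows "a \<otimes>t (b \<oplus>\<^bsub>B\<^esub> b') = a \<otimes>t b \<oplus>\<^bsub>T\<^esub> a \<otimes>t b'"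
proof -
  have "single K (a, b \<oplus>\<^bsub>B\<^esub> b') \<ominus>\<^bsub>F\<^esub> (single K (a, b) \<oplus>\<^bsub>F\<^esub> single K (a, b')) \<in> J"
    by (intro subsetD[OF J_rels] relsI assms)
  then show ?thesis unfolding pure_tensor_def using assms
    by (simp add: T_add coset_eq single_closed)
qed

lemma pt_smult_left: assumes "k \<in> carrier K" "a \<in> carrier A" "b \<in> carrier B"
  shows "(k \<odot>\<^bsub>A\<^esub> a) \<otimes>t b = k \<odot>\<^bsub>T\<^esub> (a \<otimes>t b)"
proof -
  have "single K (k \<odot>\<^bsub>A\<^esub> a, b) \<ominus>\<^bsub>F\<^esub> k \<odot>\<^bsub>F\<^esub> single K (a, b) \<in> J"
    by (intro subsetD[OF J_rels] relsI assms)
  then show ?thesis unfolding pure_tensor_def using assms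
    by (simp add: T_smult coset_eq single_closed)
qed

lemma pt_smult_right: assumes "k \<in> carrier K" "a \<in> carrier A" "b \<in> carrier B"
  shows "a \<otimes>t (k \<odot>\<^bsub>B\<^esub> b) = k \<odot>\<^bsub>T\<^esub> (a \<otimes>t b)"
proof -
  have "single K (a, k \<odot>\<^bsub>B\<^esub> b) \<ominus>\<^bsub>F\<^esub> k \<odot>\<^bsub>F\<^esub> single K (a, b) \<in> J"
    by (intro subsetD[OF J_rels] relsI assms)
  then show ?thesis unfolding pure_tensor_def using assms
    by (simp add: T_smult coset_eq single_closed)
qed

lemma pt_mult: "\<lbrakk>a \<in> carrier A; a' \<in> carrier A; b \<in> carrier B; b' \<in> carrier B\<rbrakk> \<Longrightarrow>
    (a \<otimes>t b) \<otimes>\<^bsub>T\<^esub> (a' \<otimes>t b') = (a \<otimes>\<^bsub>A\<^esub> a') \<otimes>t (b \<otimes>\<^bsub>B\<^esub> b')"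
  unfolding pure_tensor_def by (simp add: T_mult mult_single single_closed)

lemma tensor_induct [consumes 1, case_names zero add]:
  assumes x: "x \<in> carrier T" and z: "P \<zero>\<^bsub>T\<^esub>"
    and s: "\<And>a b y. \<lbrakk>a \<in> carrier A; b \<in> carrier B; y \<in> carrier T; P y\<rbrakk> \<Longrightarrow> P (a \<otimes>t b \<oplus>\<^bsub>T\<^esub> y)"
  shows "P x"
proof -
  obtain f where f: "f \<in> carrier F" "x = J +>\<^bsub>F\<^esub> f" using x unfolding T_carrier by blast
  have J0: "J +>\<^bsub>F\<^esub> \<zero>\<^bsub>F\<^esub> = \<zero>\<^bsub>T\<^esub>"
    unfolding T_zero using J_zero Fm.zero_closed J.a_rcos_const by simp
  from f(1) have "P (J +>\<^bsub>F\<^esub> f)"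
  proof (induction rule: F_induct)
    case zero
    then show ?case using z J0 by simp
  next
    case (add k p g)
    obtain a b where p: "p = (a, b)" "a \<in> carrier A" "b \<in> carrier B" using add(2) by auto
    have g: "J +>\<^bsub>F\<^esub> g \<in> carrier T" using add(3) by (auto simp: T_carrier)
    have "J +>\<^bsub>F\<^esub> (k \<odot>\<^bsub>F\<^esub> single K p \<oplus>\<^bsub>F\<^esub> g) = (k \<odot>\<^bsub>A\<^esub> a) \<otimes>t b \<oplus>\<^bsub>T\<^esub> (J +>\<^bsub>F\<^esub> g)"
      unfolding pt_smult_left[OF add(1) p(2,3)] unfolding pure_tensor_def p(1)[symmetric]
      using add by (simp add: T_smult T_add single_closed)
    then show ?case using s[OF _ p(3) g add(4), of "k \<odot>\<^bsub>A\<^esub> a"] add(1) p by simp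
  qed
  then show ?thesis using f by simp
qed

lemma tensor_lift:
  fixes M (structure)
  assumes M: "module K M"
    and c: "\<And>a b. \<lbrakk>a \<in> carrier A; b \<in> carrier B\<rbrakk> \<Longrightarrow> \<phi> a b \<in> carrier M"
    and al: "\<And>a a' b. \<lbrakk>a \<in> carrier A; a' \<in> carrier A; b \<in> carrier B\<rbrakk> \<Longrightarrow>
      \<phi> (a \<oplus>\<^bsub>A\<^esub> a') b = \<phi> a b \<oplus>\<^bsub>M\<^esub> \<phi> a' b"
    and ar: "\<And>a b b'. \<lbrakk>a \<in> carrier A; b \<in> carrier B; b' \<in> carrier B\<rbrakk> \<Longrightarrow>
      \<phi> a (b \<oplus>\<^bsub>B\<^esub> b') = \<phi> a b \<oplus>\<^bsub>M\<^esub> \<phi> a b'"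
    and sl: "\<And>k a b. \<lbrakk>k \<in> carrier K; a \<in> carrier A; b \<in> carrier B\<rbrakk> \<Longrightarrow>
      \<phi> (k \<odot>\<^bsub>A\<^esub> a) b = k \<odot>\<^bsub>M\<^esub> \<phi> a b"
    and sr: "\<And>k a b. \<lbrakk>k \<in> carrier K; a \<in> carrier A; b \<in> carrier B\<rbrakk> \<Longrightarrow>
      \<phi> a (k \<odot>\<^bsub>B\<^esub> b) = k \<odot>\<^bsub>M\<^esub> \<phi> a b"
  obtains h where "\<And>x. x \<in> carrier T \<Longrightarrow> h x \<in> carrier M"
    and "\<And>x y. \<lbrakk>x \<in> carrier T; y \<in> carrier T\<rbrakk> \<Longrightarrow> h (x \<oplus>\<^bsub>T\<^esub> y) = h x \<oplus>\<^bsub>M\<^esub> h y"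
    and "\<And>k x. \<lbrakk>k \<in> carrier K; x \<in> carrier T\<rbrakk> \<Longrightarrow> h (k \<odot>\<^bsub>T\<^esub> x) = k \<odot>\<^bsub>M\<^esub> h x"
    and "\<And>a b. \<lbrakk>a \<in> carrier A; b \<in> carrier B\<rbrakk> \<Longrightarrow> h (a \<otimes>t b) = \<phi> a b"
proof -
  interpret M: module K M by fact
  define H where "H f = (\<Oplus>\<^bsub>M\<^esub>p \<in> supp f. f p \<odot>\<^bsub>M\<^esub> \<phi> (fst p) (snd p))" for f
  have cp: "f p \<odot>\<^bsub>M\<^esub> \<phi> (fst p) (snd p) \<in> carrier M"
    if "f \<in> carrier F" "p \<in> carrier (A \<times>\<times> B)" for f p
    using that c by (cases p) (simp add: M.smult_closed)
  have Hon: "H f = (\<Oplus>\<^bsub>M\<^esub>p \<in> S. f p \<odot>\<^bsub>M\<^esub> \<phi> (fst p) (snd p))"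
    if "f \<in> carrier F" "finite S" "supp f \<subseteq> S" "S \<subseteq> carrier (A \<times>\<times> B)" for f S
    unfolding H_def
    by (rule M.add.finprod_mono_neutral_cong_left) (use that cp in \<open>auto simp: c subset_iff\<close>)
  have sf: "supp f \<subseteq> carrier (A \<times>\<times> B)" "finite (supp f)" if "f \<in> carrier F" for f
    using that unfolding F_carrier by auto
  have Hc: "H f \<in> carrier M" if "f \<in> carrier F" for f
    unfolding H_def by (rule M.add.finprod_closed) (use that cp sf in blast)
  have Ha: "H (f \<oplus>\<^bsub>F\<^esub> g) = H f \<oplus>\<^bsub>M\<^esub> H g" if f: "f \<in> carrier F" and g: "g \<in> carrier F" for f g
  proof -
    let ?S = "supp f \<union> supp g"
    have S: "finite ?S" "?S \<subseteq> carrier (A \<times>\<times> B)" using sf f g by auto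
    have s: "supp (f \<oplus>\<^bsub>F\<^esub> g) \<subseteq> ?S" by (auto simp: F_simps)
    have cc: "(\<lambda>p. f p \<odot>\<^bsub>M\<^esub> \<phi> (fst p) (snd p)) \<in> ?S \<rightarrow> carrier M"
      "(\<lambda>p. g p \<odot>\<^bsub>M\<^esub> \<phi> (fst p) (snd p)) \<in> ?S \<rightarrow> carrier M"
      using cp f g S(2) by blast+
    show ?thesis
      unfolding Hon[OF F_add_closed[OF f g] S(1) s S(2)] Hon[OF f S(1) Un_upper1 S(2)]
        Hon[OF g S(1) Un_upper2 S(2)] M.add.finprod_multf[OF cc, symmetric]
    proof (rule M.add.finprod_cong'[OF refl])
      show "(\<lambda>p. f p \<odot>\<^bsub>M\<^esub> \<phi> (fst p) (snd p) \<oplus>\<^bsub>M\<^esub> g p \<odot>\<^bsub>M\<^esub> \<phi> (fst p) (snd p)) \<in> ?S \<rightarrow> carrier M"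
        using cc by (simp add: Pi_def)
      fix p assume "p \<in> ?S"
      then have "fst p \<in> carrier A" "snd p \<in> carrier B" using S(2) by auto
      then show "(f \<oplus>\<^bsub>F\<^esub> g) p \<odot>\<^bsub>M\<^esub> \<phi> (fst p) (snd p) =
          f p \<odot>\<^bsub>M\<^esub> \<phi> (fst p) (snd p) \<oplus>\<^bsub>M\<^esub> g p \<odot>\<^bsub>M\<^esub> \<phi> (fst p) (snd p)"
        using f g by (simp add: F_simps c M.smult_l_distr)
    qed
  qed
  have Hs: "H (k \<odot>\<^bsub>F\<^esub> f) = k \<odot>\<^bsub>M\<^esub> H f" if k: "k \<in> carrier K" and f: "f \<in> carrier F" for k f
  proof -
    have s: "supp (k \<odot>\<^bsub>F\<^esub> f) \<subseteq> supp f" using k by (auto simp: F_simps)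
    have cc: "(\<lambda>p. f p \<odot>\<^bsub>M\<^esub> \<phi> (fst p) (snd p)) \<in> supp f \<rightarrow> carrier M"
      using cp f sf(1) by blast
    show ?thesis
      unfolding Hon[OF F_smult_closed[OF k f] sf(2)[OF f] s sf(1)[OF f]]
        H_def[of f] M.finsum_smult_ldistr[OF sf(2)[OF f] k cc]
      by (rule M.add.finprod_cong')
        (use sf(1)[OF f] f k cp in \<open>auto simp: F_simps c M.smult_assoc1 subset_iff\<close>)
  qed
  have H1: "H (single K (a, b)) = \<phi> a b" if "a \<in> carrier A" "b \<in> carrier B" for a b
  proof -
    have s: "finite {(a,b)}" "supp (single K (a,b)) \<subseteq> {(a,b)}" "{(a,b)} \<subseteq> carrier (A \<times>\<times> B)"
      using that by (auto simp: single_def)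
    have "single K (a, b) \<in> carrier F" by (rule single_closed) (use that in simp)
    from Hon[OF this s] show ?thesis using that c by (simp add: single_def Pi_def)
  qed
  let ?N = "{f \<in> carrier F. H f = \<zero>\<^bsub>M\<^esub>}"
  have H0: "H \<zero>\<^bsub>F\<^esub> = \<zero>\<^bsub>M\<^esub>" unfolding H_def by (simp add: F_simps)
  have Hn: "H (\<ominus>\<^bsub>F\<^esub> f) = \<ominus>\<^bsub>M\<^esub> H f" if "f \<in> carrier F" for f
  proof -
    have "H (\<ominus>\<^bsub>F\<^esub> f) \<oplus>\<^bsub>M\<^esub> H f = \<zero>\<^bsub>M\<^esub>"
      using Ha[of "\<ominus>\<^bsub>F\<^esub> f" f] that H0 by (simp add: Fm.l_neg)
    then show ?thesis using that Hc by (simp add: M.minus_equality)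
  qed
  have Hm: "H (f \<ominus>\<^bsub>F\<^esub> g) = H f \<ominus>\<^bsub>M\<^esub> H g" if "f \<in> carrier F" "g \<in> carrier F" for f g
    using that by (simp add: a_minus_def Ha Hn)
  have N: "submodule ?N K F"
    by (rule Fm.submoduleI) (auto simp: H0 Hn Ha Hs)
  have "tensor_relations K A B \<subseteq> ?N"
  proof
    fix x assume x: "x \<in> tensor_relations K A B"
    then have "x \<in> carrier F" using rels_sub by blast
    moreover have "H x = \<zero>\<^bsub>M\<^esub>"
      using x
    proof (cases rule: rels_cases)
    qed (simp_all add: Hm Ha Hs H1 single_closed c al ar sl sr M.r_neg a_minus_def[of M])
    ultimately show "x \<in> ?N" by simp
  qed
  then have JN: "J \<subseteq> ?N" by (rule J_least[OF N])
  define h where "h X = H (SOME f. f \<in> carrier F \<and> X = J +>\<^bsub>F\<^esub> f)" for X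
  have hH: "h (J +>\<^bsub>F\<^esub> f) = H f" if f: "f \<in> carrier F" for f
  proof -
    define g where "g = (SOME g. g \<in> carrier F \<and> J +>\<^bsub>F\<^esub> f = J +>\<^bsub>F\<^esub> g)"
    have "\<exists>g. g \<in> carrier F \<and> J +>\<^bsub>F\<^esub> f = J +>\<^bsub>F\<^esub> g" using f by blast
    from someI_ex[OF this] have g: "g \<in> carrier F" "J +>\<^bsub>F\<^esub> f = J +>\<^bsub>F\<^esub> g"
      unfolding g_def[symmetric] by blast+
    have "g \<in> J +>\<^bsub>F\<^esub> f" unfolding g(2) by (rule J.a_rcos_self[OF g(1)])
    then obtain j where j: "j \<in> J" "g = j \<oplus>\<^bsub>F\<^esub> f" by (auto simp: a_r_coset_def')
    have "j \<in> carrier F" "H j = \<zero>\<^bsub>M\<^esub>" using JN j(1) by auto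
    then have "H g = H f" unfolding j(2) using f Ha Hc by simp
    then show ?thesis unfolding h_def g_def .
  qed
  show thesis
  proof (rule that[of h])
    show "h x \<in> carrier M" if x: "x \<in> carrier T" for x
    proof -
      obtain f where f: "f \<in> carrier F" "x = J +>\<^bsub>F\<^esub> f" using x unfolding T_carrier by blast
      show ?thesis unfolding f(2) hH[OF f(1)] by (rule Hc[OF f(1)])
    qed
    show "h (x \<oplus>\<^bsub>T\<^esub> y) = h x \<oplus>\<^bsub>M\<^esub> h y" if x: "x \<in> carrier T" and y: "y \<in> carrier T" for x y
    proof -
      obtain f where f: "f \<in> carrier F" "x = J +>\<^bsub>F\<^esub> f" using x unfolding T_carrier by (rule imageE)
      obtain g where g: "g \<in> carrier F" "y = J +>\<^bsub>F\<^esub> g" using y unfolding T_carrier by (rule imageE)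
      show ?thesis
        unfolding f(2) g(2) T_add[OF f(1) g(1)] hH[OF f(1)] hH[OF g(1)]
          hH[OF F_add_closed[OF f(1) g(1)]] by (rule Ha[OF f(1) g(1)])
    qed
    show "h (k \<odot>\<^bsub>T\<^esub> x) = k \<odot>\<^bsub>M\<^esub> h x" if k: "k \<in> carrier K" and x: "x \<in> carrier T" for k x
    proof -
      obtain f where f: "f \<in> carrier F" "x = J +>\<^bsub>F\<^esub> f" using x unfolding T_carrier by (rule imageE)
      show ?thesis
        unfolding f(2) T_smult[OF k f(1)] hH[OF f(1)] hH[OF F_smult_closed[OF k f(1)]]
        by (rule Hs[OF k f(1)])
    qed
    show "h (a \<otimes>t b) = \<phi> a b" if ab: "a \<in> carrier A" "b \<in> carrier B" for a b
    proof -
      have "single K (a, b) \<in> carrier F" by (rule single_closed) (use ab in simp)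
      from hH[OF this] show ?thesis unfolding pure_tensor_def H1[OF ab] .
    qed
  qed
qed

end

end

theory Submission
  imports Defs
begin

text \<open>
  The counterexample is \<open>A = K[x, y] / (x\<^sup>2, y\<^sup>2)\<close> with the Poisson bracket given by \<open>[x, y] = xy\<close>,
  and the dual numbers \<open>B = K[\<epsilon>] / (\<epsilon>\<^sup>2)\<close> with \<open>[f, g] = D(f) g - f D(g)\<close>, where \<open>D\<close> is the
  derivation with \<open>D(\<epsilon>) = \<epsilon>\<close>.

  Suppose a contact bracket on \<open>A \<otimes> B\<close> extends both.  The derivation \<open>[_, 1]\<close> of \<open>A \<otimes> B\<close> vanishes on
  \<open>A \<otimes> 1\<close> and is the identity on \<open>A \<otimes> \<epsilon>\<close>.  By the Jacobi identity it also respects the bracket, so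
  it fixes \<open>[a \<otimes> 1, 1 \<otimes> \<epsilon>]\<close> for every \<open>a \<in> A\<close>, and this element has the form \<open>P(a) \<otimes> \<epsilon>\<close>.  The contact
  identity for \<open>[ab, \<epsilon>]\<close> and the Jacobi identity for \<open>[[a, b], \<epsilon>]\<close> then become
    \<open>P(ab) = P(a) b + P(b) a + ab\<close>  and  \<open>P([a, b]) = [P(a), b] + [a, P(b)]\<close>
  (lemma \<open>ex_twisted_derivation\<close>, which holds for every Poisson algebra \<open>A\<close>).  Equivalently,
  \<open>\<delta> = P + id\<close> is a derivation of \<open>A\<close> with \<open>\<delta>([a, b]) = [\<delta>(a), b] + [a, \<delta>(b)] - [a, b]\<close>, that is, the
  Poisson bivector is the Lie derivative of itself along a vector field.

  The bracket \<open>[x, y] = xy\<close> admits no such \<open>P\<close>.  Let \<open>p\<close> and \<open>q\<close> be the coefficients of \<open>x\<close> in \<open>P(x)\<close>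
  and of \<open>y\<close> in \<open>P(y)\<close>.  Since \<open>[x, y] = xy\<close>, the coefficient of \<open>xy\<close> in \<open>P(xy)\<close> is \<open>p + q + 1\<close> by the
  first identity and \<open>p + q\<close> by the second (lemma \<open>no_extension\<close>).
\<close>

section \<open>Consequences of the Lie axioms\<close>

context lie_bracket
begin

lemma br_zero_left: "b \<in> carrier A \<Longrightarrow> br \<zero>\<^bsub>A\<^esub> b = \<zero>\<^bsub>A\<^esub>"
  using br_smult_left[of \<zero> "\<zero>\<^bsub>A\<^esub>" b] by (simp add: br_closed)

lemma br_zero_right: "a \<in> carrier A \<Longrightarrow> br a \<zero>\<^bsub>A\<^esub> = \<zero>\<^bsub>A\<^esub>"
  using br_smult_right[of \<zero> a "\<zero>\<^bsub>A\<^esub>"] by (simp add: br_closed)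

lemma br_antisym:
  assumes "a \<in> carrier A" "b \<in> carrier A"
  shows "br b a = \<ominus>\<^bsub>A\<^esub> br a b"
proof -
  have "\<zero>\<^bsub>A\<^esub> = br (a \<oplus>\<^bsub>A\<^esub> b) (a \<oplus>\<^bsub>A\<^esub> b)" using assms by (simp add: br_self)
  also have "\<dots> = br b a \<oplus>\<^bsub>A\<^esub> br a b"
    using assms by (subst br_add_left) (simp_all add: br_add_right br_self br_closed M.a_comm)
  finally show ?thesis using assms by (simp add: br_closed M.minus_equality)
qed

lemma br_minus_right:
  assumes "a \<in> carrier A" "b \<in> carrier A"
  shows "br a (\<ominus>\<^bsub>A\<^esub> b) = \<ominus>\<^bsub>A\<^esub> br a b"
proof -
  have "br a (\<ominus>\<^bsub>A\<^esub> b) \<oplus>\<^bsub>A\<^esub> br a b = \<zero>\<^bsub>A\<^esub>"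
    using br_add_right[of a "\<ominus>\<^bsub>A\<^esub> b" b] assms by (simp add: M.l_neg br_zero_right)
  then show ?thesis using assms by (simp add: br_closed M.minus_equality)
qed

text \<open>The Jacobi identity, read as: \<open>br _ c\<close> is a derivation of the bracket.\<close>
lemma br_br:
  assumes "a \<in> carrier A" "b \<in> carrier A" "c \<in> carrier A"
  shows "br (br a b) c = br (br a c) b \<oplus>\<^bsub>A\<^esub> br a (br b c)"
proof -
  have 1: "br (br a b) c = \<ominus>\<^bsub>A\<^esub> br c (br a b)"
    using br_antisym[of c "br a b"] assms by (simp add: br_closed)
  have 2: "br (br a c) b = br b (br c a)"
    using br_antisym[of b "br a c"] br_antisym[of a c] assms
    by (simp add: br_closed br_minus_right)
  have "(br (br a c) b \<oplus>\<^bsub>A\<^esub> br a (br b c)) \<oplus>\<^bsub>A\<^esub> br c (br a b) = \<zero>\<^bsub>A\<^esub>"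
    using jacobi[OF assms] unfolding 2 using assms by (simp add: br_closed M.a_comm)
  then show ?thesis unfolding 1 using assms by (simp add: br_closed M.minus_equality)
qed

end

section \<open>Extensions to the tensor product with the dual numbers\<close>

text \<open>
  A contact bracket on \<open>A \<otimes> B\<close> extending a Poisson bracket on \<open>A\<close> and a contact bracket on \<open>B\<close>, where
  \<open>B\<close> is spanned by \<open>1\<close> and an eigenvector \<open>\<epsilon>\<close> of \<open>[_, 1]\<close> with eigenvalue \<open>1\<close>.  The linear form \<open>coeff\<close>
  takes the coefficient of \<open>\<epsilon>\<close>.
\<close>
locale dual_number_extension = tensor K A B + PA: poisson_bracket K A brA
  + PB: contact_bracket K B brB + PT: contact_bracket K "tensor_product K A B" br
  for K (structure) and A (structure) and B (structure) and brA brB br +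
  fixes \<epsilon> and coeff
  assumes ext: "extends_brackets K A B brA brB br"
    and eps: "\<epsilon> \<in> carrier B" "brB \<epsilon> \<one>\<^bsub>B\<^esub> = \<epsilon>"
    and coeff_closed: "b \<in> carrier B \<Longrightarrow> coeff b \<in> carrier K"
    and coeff_add: "\<lbrakk>b \<in> carrier B; b' \<in> carrier B\<rbrakk> \<Longrightarrow> coeff (b \<oplus>\<^bsub>B\<^esub> b') = coeff b \<oplus> coeff b'"
    and coeff_smult: "\<lbrakk>k \<in> carrier K; b \<in> carrier B\<rbrakk> \<Longrightarrow> coeff (k \<odot>\<^bsub>B\<^esub> b) = k \<otimes> coeff b"
    and coeff_eps: "coeff \<epsilon> = \<one>"
    and decomp: "b \<in> carrier B \<Longrightarrow> \<exists>k\<in>carrier K. b = k \<odot>\<^bsub>B\<^esub> \<one>\<^bsub>B\<^esub> \<oplus>\<^bsub>B\<^esub> coeff b \<odot>\<^bsub>B\<^esub> \<epsilon>"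
begin

text \<open>The embedding of \<open>A\<close>, and the image of \<open>\<epsilon>\<close>, in the tensor product.\<close>
abbreviation inA where "inA a \<equiv> a \<otimes>t \<one>\<^bsub>B\<^esub>"

abbreviation E where "E \<equiv> \<one>\<^bsub>A\<^esub> \<otimes>t \<epsilon>"

lemma inA_closed [simp]: "a \<in> carrier A \<Longrightarrow> inA a \<in> carrier T"
  by (simp add: pt_closed)

lemma E_closed [simp]: "E \<in> carrier T"
  by (simp add: pt_closed eps)

lemma br_inA: "\<lbrakk>a \<in> carrier A; a' \<in> carrier A\<rbrakk> \<Longrightarrow> br (inA a) (inA a') = inA (brA a a')"
  using ext by (simp add: extends_brackets_def)

lemma inA_eps: "a \<in> carrier A \<Longrightarrow> inA a \<otimes>\<^bsub>T\<^esub> E = a \<otimes>t \<epsilon>"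
  by (simp add: pt_mult eps)

lemma inA_zero: "inA \<zero>\<^bsub>A\<^esub> = \<zero>\<^bsub>T\<^esub>"
  using pt_smult_left[of \<zero> "\<zero>\<^bsub>A\<^esub>" "\<one>\<^bsub>B\<^esub>"] by simp

lemma br_inA_one: "a \<in> carrier A \<Longrightarrow> br (inA a) \<one>\<^bsub>T\<^esub> = \<zero>\<^bsub>T\<^esub>"
  using br_inA[of a "\<one>\<^bsub>A\<^esub>"] by (simp add: T_one PA.br_one inA_zero)

lemma br_E_one: "br E \<one>\<^bsub>T\<^esub> = E"
  using ext eps by (simp add: extends_brackets_def T_one)

lemma pt_eps_inj:
  assumes "u \<in> carrier A" "v \<in> carrier A" "u \<otimes>t \<epsilon> = v \<otimes>t \<epsilon>"
  shows "u = v"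
proof -
  \<comment> \<open>the form \<open>coeff\<close> induces a linear map from the tensor product to \<open>A\<close> that sends \<open>a \<otimes> \<epsilon>\<close> to \<open>a\<close>\<close>
  have l: "k \<odot>\<^bsub>A\<^esub> (l \<odot>\<^bsub>A\<^esub> a) = l \<odot>\<^bsub>A\<^esub> (k \<odot>\<^bsub>A\<^esub> a)"
    if "k \<in> carrier K" "l \<in> carrier K" "a \<in> carrier A" for k l a
    using that by (metis A.smult_assoc1 A.R.m_comm)
  obtain h where "\<And>a b. \<lbrakk>a \<in> carrier A; b \<in> carrier B\<rbrakk> \<Longrightarrow> h (a \<otimes>t b) = coeff b \<odot>\<^bsub>A\<^esub> a"
    by (rule tensor_lift[of A "\<lambda>a b. coeff b \<odot>\<^bsub>A\<^esub> a"])
      (auto simp: A.module_axioms coeff_closed coeff_add coeff_smult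
        A.smult_l_distr A.smult_r_distr A.smult_assoc1 l)
  then show ?thesis using assms eps coeff_eps by (metis A.smult_one)
qed

lemma br_pt_eps_one:
  assumes "v \<in> carrier A"
  shows "br (v \<otimes>t \<epsilon>) \<one>\<^bsub>T\<^esub> = v \<otimes>t \<epsilon>"
proof -
  have "br (inA v \<otimes>\<^bsub>T\<^esub> E) \<one>\<^bsub>T\<^esub> = inA v \<otimes>\<^bsub>T\<^esub> E"
    using assms by (simp add: PT.contact_identity br_inA_one br_E_one PT.br_self T.m_comm)
  then show ?thesis using assms by (simp add: inA_eps)
qed

lemma tensor_decomp:
  assumes "z \<in> carrier T"
  shows "\<exists>u\<in>carrier A. \<exists>v\<in>carrier A. z = inA u \<oplus>\<^bsub>T\<^esub> v \<otimes>t \<epsilon>"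
  using assms
proof (induction rule: tensor_induct)
  case zero
  have "\<zero>\<^bsub>A\<^esub> \<otimes>t \<epsilon> = \<zero>\<^bsub>T\<^esub>"
    using pt_smult_left[of \<zero> "\<zero>\<^bsub>A\<^esub>" \<epsilon>] eps by (simp add: pt_closed)
  then show ?case by (intro bexI[of _ "\<zero>\<^bsub>A\<^esub>"]) (simp_all add: inA_zero)
next
  case (add a b y)
  obtain u v where uv: "u \<in> carrier A" "v \<in> carrier A" "y = inA u \<oplus>\<^bsub>T\<^esub> v \<otimes>t \<epsilon>"
    using add by blast
  obtain k where k: "k \<in> carrier K" "b = k \<odot>\<^bsub>B\<^esub> \<one>\<^bsub>B\<^esub> \<oplus>\<^bsub>B\<^esub> coeff b \<odot>\<^bsub>B\<^esub> \<epsilon>"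
    using decomp add by blast
  define l where "l = coeff b"
  have l: "l \<in> carrier K" using add by (simp add: l_def coeff_closed)
  have "a \<otimes>t b = inA (k \<odot>\<^bsub>A\<^esub> a) \<oplus>\<^bsub>T\<^esub> (l \<odot>\<^bsub>A\<^esub> a) \<otimes>t \<epsilon>"
    using add k(1) l eps by (subst k(2))
      (simp add: l_def[symmetric] pt_add_right pt_smult_left pt_smult_right)
  then have "a \<otimes>t b \<oplus>\<^bsub>T\<^esub> y = inA (k \<odot>\<^bsub>A\<^esub> a \<oplus>\<^bsub>A\<^esub> u) \<oplus>\<^bsub>T\<^esub> (l \<odot>\<^bsub>A\<^esub> a \<oplus>\<^bsub>A\<^esub> v) \<otimes>t \<epsilon>"
    using add k(1) l uv eps by (simp add: pt_add_left pt_closed T.a_ac)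
  then show ?case using add k(1) l uv by blast
qed

text \<open>
  As \<open>[_, 1]\<close> is a derivation of the bracket, it fixes \<open>[a \<otimes> 1, 1 \<otimes> \<epsilon>]\<close>; its fixed space is \<open>A \<otimes> \<epsilon>\<close>.
\<close>
lemma br_inA_E:
  assumes "a \<in> carrier A"
  shows "\<exists>v\<in>carrier A. br (inA a) E = v \<otimes>t \<epsilon>"
proof -
  let ?z = "br (inA a) E"
  have z: "?z \<in> carrier T" using assms by (simp add: PT.br_closed)
  obtain u v where uv: "u \<in> carrier A" "v \<in> carrier A" "?z = inA u \<oplus>\<^bsub>T\<^esub> v \<otimes>t \<epsilon>"
    using tensor_decomp[OF z] by blast
  have "?z = br ?z \<one>\<^bsub>T\<^esub>"
    using assms z PT.br_br[of "inA a" E "\<one>\<^bsub>T\<^esub>"]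
    by (simp add: br_inA_one br_E_one PT.br_zero_left)
  also have "\<dots> = v \<otimes>t \<epsilon>"
    using uv eps by (simp add: PT.br_add_left br_inA_one br_pt_eps_one pt_closed)
  finally show ?thesis using uv by blast
qed

text \<open>The condition on the Poisson algebra \<open>A\<close> that an extension of the brackets imposes.\<close>
lemma ex_twisted_derivation:
  "\<exists>P\<in>carrier A \<rightarrow> carrier A.
    (\<forall>a\<in>carrier A. \<forall>b\<in>carrier A.
      P (a \<otimes>\<^bsub>A\<^esub> b) = P a \<otimes>\<^bsub>A\<^esub> b \<oplus>\<^bsub>A\<^esub> P b \<otimes>\<^bsub>A\<^esub> a \<oplus>\<^bsub>A\<^esub> a \<otimes>\<^bsub>A\<^esub> b) \<and>
    (\<forall>a\<in>carrier A. \<forall>b\<in>carrier A. P (brA a b) = brA (P a) b \<oplus>\<^bsub>A\<^esub> brA a (P b))"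
proof -
  obtain P where Pc: "\<And>a. a \<in> carrier A \<Longrightarrow> P a \<in> carrier A"
    and P: "\<And>a. a \<in> carrier A \<Longrightarrow> br (inA a) E = P a \<otimes>t \<epsilon>"
    using br_inA_E by metis
  note cl = Pc eps pt_closed PA.br_closed PT.br_closed
  have bridge: "inA u \<otimes>\<^bsub>T\<^esub> (v \<otimes>t \<epsilon>) = (u \<otimes>\<^bsub>A\<^esub> v) \<otimes>t \<epsilon>" "(v \<otimes>t \<epsilon>) \<otimes>\<^bsub>T\<^esub> inA u = (v \<otimes>\<^bsub>A\<^esub> u) \<otimes>t \<epsilon>"
    if "u \<in> carrier A" "v \<in> carrier A" for u v
    using that eps by (simp_all add: pt_mult)
  have minus: "\<ominus>\<^bsub>T\<^esub> (u \<otimes>t \<epsilon>) = (\<ominus>\<^bsub>A\<^esub> u) \<otimes>t \<epsilon>" if "u \<in> carrier A" for u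
  proof -
    have "(\<ominus>\<^bsub>A\<^esub> u) \<otimes>t \<epsilon> \<oplus>\<^bsub>T\<^esub> u \<otimes>t \<epsilon> = (\<zero> \<odot>\<^bsub>A\<^esub> u) \<otimes>t \<epsilon>"
      using that eps by (simp add: pt_add_left[symmetric] A.l_neg)
    also have "\<dots> = \<zero>\<^bsub>T\<^esub>"
      using that eps pt_smult_left[of \<zero> u \<epsilon>] by (simp add: pt_closed del: A.smult_l_null)
    finally show ?thesis using that eps by (simp add: T.minus_equality pt_closed)
  qed
  show ?thesis
  proof (intro bexI[of _ P] conjI ballI)
    fix a b assume ab: "a \<in> carrier A" "b \<in> carrier A"
    have "P (a \<otimes>\<^bsub>A\<^esub> b) \<otimes>t \<epsilon> = br (inA a \<otimes>\<^bsub>T\<^esub> inA b) E"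
      using ab by (simp add: P[symmetric] pt_mult)
    also have "\<dots> = (P a \<otimes>\<^bsub>A\<^esub> b) \<otimes>t \<epsilon> \<oplus>\<^bsub>T\<^esub> (P b \<otimes>\<^bsub>A\<^esub> a) \<otimes>t \<epsilon> \<oplus>\<^bsub>T\<^esub> (a \<otimes>\<^bsub>A\<^esub> b) \<otimes>t \<epsilon>"
      using ab by (subst PT.contact_identity) (simp_all add: P br_E_one bridge cl pt_mult)
    finally show "P (a \<otimes>\<^bsub>A\<^esub> b) = P a \<otimes>\<^bsub>A\<^esub> b \<oplus>\<^bsub>A\<^esub> P b \<otimes>\<^bsub>A\<^esub> a \<oplus>\<^bsub>A\<^esub> a \<otimes>\<^bsub>A\<^esub> b"
      using ab by (intro pt_eps_inj) (simp_all add: cl pt_add_left)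
  next
    fix a b assume ab: "a \<in> carrier A" "b \<in> carrier A"
    have br_eps: "br (u \<otimes>t \<epsilon>) (inA c) = (brA u c \<ominus>\<^bsub>A\<^esub> P c \<otimes>\<^bsub>A\<^esub> u) \<otimes>t \<epsilon>"
      if "u \<in> carrier A" "c \<in> carrier A" for u c
    proof -
      have "br (inA u \<otimes>\<^bsub>T\<^esub> E) (inA c)
          = br (inA u) (inA c) \<otimes>\<^bsub>T\<^esub> E \<oplus>\<^bsub>T\<^esub> (\<ominus>\<^bsub>T\<^esub> br (inA c) E) \<otimes>\<^bsub>T\<^esub> inA u"
        using that by (simp add: PT.contact_identity br_inA_one PT.br_closed PT.br_antisym[of "inA c" E])
      then show ?thesis
        using that by (simp add: inA_eps br_inA P minus cl bridge pt_add_left a_minus_def A.l_minus)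
    qed
    have "P (brA a b) \<otimes>t \<epsilon> = br (br (inA a) (inA b)) E"
      using ab by (simp add: P[symmetric] br_inA cl)
    also have "\<dots> = br (P a \<otimes>t \<epsilon>) (inA b) \<oplus>\<^bsub>T\<^esub> br (inA a) (P b \<otimes>t \<epsilon>)"
      using ab PT.br_br[of "inA a" "inA b" E] by (simp add: P)
    also have "br (inA a) (P b \<otimes>t \<epsilon>) = \<ominus>\<^bsub>T\<^esub> br (P b \<otimes>t \<epsilon>) (inA a)"
      using ab PT.br_antisym[of "P b \<otimes>t \<epsilon>" "inA a"] by (simp add: cl)
    also have "br (P a \<otimes>t \<epsilon>) (inA b) \<oplus>\<^bsub>T\<^esub> \<dots> =
      ((brA (P a) b \<ominus>\<^bsub>A\<^esub> P b \<otimes>\<^bsub>A\<^esub> P a) \<oplus>\<^bsub>A\<^esub> \<ominus>\<^bsub>A\<^esub> (brA (P b) a \<ominus>\<^bsub>A\<^esub> P a \<otimes>\<^bsub>A\<^esub> P b)) \<otimes>t \<epsilon>"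
      using ab by (simp add: br_eps minus cl pt_add_left)
    also have "(brA (P a) b \<ominus>\<^bsub>A\<^esub> P b \<otimes>\<^bsub>A\<^esub> P a) \<oplus>\<^bsub>A\<^esub> \<ominus>\<^bsub>A\<^esub> (brA (P b) a \<ominus>\<^bsub>A\<^esub> P a \<otimes>\<^bsub>A\<^esub> P b)
        = brA (P a) b \<oplus>\<^bsub>A\<^esub> brA a (P b)"
    proof -
      have "brA (P a) b \<in> carrier A" "brA (P b) a \<in> carrier A" "P a \<in> carrier A" "P b \<in> carrier A"
        "brA a (P b) = \<ominus>\<^bsub>A\<^esub> brA (P b) a"
        using ab PA.br_antisym[of "P b" a] by (simp_all add: cl)
      then show ?thesis by (simp only:) algebra
    qed
    finally show "P (brA a b) = brA (P a) b \<oplus>\<^bsub>A\<^esub> brA a (P b)"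
      using ab by (intro pt_eps_inj) (simp_all add: cl)
  qed (use Pc in blast)
qed

end

section \<open>The two algebras and their brackets\<close>

text \<open>
  An element of \<open>K[x, y] / (x\<^sup>2, y\<^sup>2)\<close> is encoded by its coefficients at \<open>1, x, y, xy\<close>, placed at the
  positions \<open>0, 1, 2, 3\<close>; a function in the carrier is \<open>0\<close> from position \<open>n\<close> on.  For \<open>n = 4\<close> this is the
  whole algebra, for \<open>n = 2\<close> the subalgebra \<open>K[x] / (x\<^sup>2)\<close> of dual numbers; other values of \<open>n\<close> are not
  meant.
\<close>
definition square_zero_algebra :: "('k, 'm) ring_scheme \<Rightarrow> nat \<Rightarrow> ('k, nat \<Rightarrow> 'k) module"
  where "square_zero_algebra K n =
    \<lparr>carrier = {f. (\<forall>i. f i \<in> carrier K) \<and> (\<forall>i\<ge>n. f i = \<zero>\<^bsub>K\<^esub>)},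
     mult = (\<lambda>f g i.
       if i = 0 then f 0 \<otimes>\<^bsub>K\<^esub> g 0
       else if i = 1 then f 0 \<otimes>\<^bsub>K\<^esub> g 1 \<oplus>\<^bsub>K\<^esub> f 1 \<otimes>\<^bsub>K\<^esub> g 0
       else if i = 2 then f 0 \<otimes>\<^bsub>K\<^esub> g 2 \<oplus>\<^bsub>K\<^esub> f 2 \<otimes>\<^bsub>K\<^esub> g 0
       else if i = 3 then f 0 \<otimes>\<^bsub>K\<^esub> g 3 \<oplus>\<^bsub>K\<^esub> f 3 \<otimes>\<^bsub>K\<^esub> g 0 \<oplus>\<^bsub>K\<^esub> (f 1 \<otimes>\<^bsub>K\<^esub> g 2 \<oplus>\<^bsub>K\<^esub> f 2 \<otimes>\<^bsub>K\<^esub> g 1)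
       else \<zero>\<^bsub>K\<^esub>),
     one = (\<lambda>i. if i = 0 then \<one>\<^bsub>K\<^esub> else \<zero>\<^bsub>K\<^esub>),
     zero = (\<lambda>i. \<zero>\<^bsub>K\<^esub>),
     add = (\<lambda>f g i. f i \<oplus>\<^bsub>K\<^esub> g i),
     smult = (\<lambda>k f i. k \<otimes>\<^bsub>K\<^esub> f i)\<rparr>"

text \<open>
  The biderivation of \<open>K[x, y] / (x\<^sup>2, y\<^sup>2)\<close> with \<open>[x, y] = xy\<close>.  All brackets are multiples of \<open>xy\<close>,
  and only the coefficients at \<open>x\<close> and \<open>y\<close> contribute.
\<close>
definition log_canonical_bracket :: "('k, 'm) ring_scheme \<Rightarrow> (nat \<Rightarrow> 'k) \<Rightarrow> (nat \<Rightarrow> 'k) \<Rightarrow> nat \<Rightarrow> 'k"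
  where "log_canonical_bracket K f g =
    (\<lambda>i. if i = 3 then f 1 \<otimes>\<^bsub>K\<^esub> g 2 \<ominus>\<^bsub>K\<^esub> f 2 \<otimes>\<^bsub>K\<^esub> g 1 else \<zero>\<^bsub>K\<^esub>)"

text \<open>
  The bracket \<open>[f, g] = D(f) g - f D(g)\<close> on \<open>K[x] / (x\<^sup>2)\<close>, with \<open>D\<close> the Euler derivation, \<open>D(x) = x\<close>.
\<close>
definition euler_bracket :: "('k, 'm) ring_scheme \<Rightarrow> (nat \<Rightarrow> 'k) \<Rightarrow> (nat \<Rightarrow> 'k) \<Rightarrow> nat \<Rightarrow> 'k"
  where "euler_bracket K f g =
    (\<lambda>i. if i = 1 then f 1 \<otimes>\<^bsub>K\<^esub> g 0 \<ominus>\<^bsub>K\<^esub> f 0 \<otimes>\<^bsub>K\<^esub> g 1 else \<zero>\<^bsub>K\<^esub>)"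

context cring
begin

lemma square_zero_algebra_simps:
  fixes n
  defines "S \<equiv> square_zero_algebra R n"
  shows "f \<in> carrier S \<longleftrightarrow> (\<forall>i. f i \<in> carrier R) \<and> (\<forall>i\<ge>n. f i = \<zero>)"
    and "(f \<otimes>\<^bsub>S\<^esub> g) i = (
       if i = 0 then f 0 \<otimes> g 0
       else if i = 1 then f 0 \<otimes> g 1 \<oplus> f 1 \<otimes> g 0
       else if i = 2 then f 0 \<otimes> g 2 \<oplus> f 2 \<otimes> g 0
       else if i = 3 then f 0 \<otimes> g 3 \<oplus> f 3 \<otimes> g 0 \<oplus> (f 1 \<otimes> g 2 \<oplus> f 2 \<otimes> g 1)
       else \<zero>)"
    and "\<one>\<^bsub>S\<^esub> i = (if i = 0 then \<one> else \<zero>)"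
    and "\<zero>\<^bsub>S\<^esub> i = \<zero>"
    and "(f \<oplus>\<^bsub>S\<^esub> g) i = f i \<oplus> g i"
    and "(k \<odot>\<^bsub>S\<^esub> f) i = k \<otimes> f i"
  by (simp_all add: S_def square_zero_algebra_def)

lemma square_zero_algebra:
  assumes n: "n = 2 \<or> n = 4"
  shows "algebra R (square_zero_algebra R n)"
proof -
  let ?S = "square_zero_algebra R n"
  note s = square_zero_algebra_simps
  have ab: "abelian_group ?S"
  proof (rule abelian_groupI)
    fix f assume f: "f \<in> carrier ?S"
    show "\<exists>g\<in>carrier ?S. g \<oplus>\<^bsub>?S\<^esub> f = \<zero>\<^bsub>?S\<^esub>"
      by (rule bexI[of _ "\<lambda>i. \<ominus> f i"]) (use f in \<open>auto simp: s fun_eq_iff l_neg\<close>)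
  qed (auto simp: s fun_eq_iff a_ac)
  have cr: "cring ?S"
  proof (rule cringI[OF ab])
    show "comm_monoid ?S"
    proof (rule comm_monoidI)
      show "f \<otimes>\<^bsub>?S\<^esub> g \<in> carrier ?S" if "f \<in> carrier ?S" "g \<in> carrier ?S" for f g
        using that n by (auto simp: s)
      show "\<one>\<^bsub>?S\<^esub> \<in> carrier ?S" using n by (auto simp: s)
    qed (use n in \<open>auto simp: s fun_eq_iff l_distr r_distr m_ac a_ac\<close>)
  qed (auto simp: s fun_eq_iff l_distr r_distr a_ac)
  show ?thesis
    by (rule algebraI[OF is_cring cr])
      (auto simp: s fun_eq_iff l_distr r_distr m_ac)
qed

lemma log_canonical_poisson: "poisson_bracket R (square_zero_algebra R 4) (log_canonical_bracket R)"
proof -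
  let ?S = "square_zero_algebra R 4"
  note s = square_zero_algebra_simps log_canonical_bracket_def fun_eq_iff
  show ?thesis
  proof (intro poisson_bracket.intro contact_bracket.intro lie_bracket.intro bracket.intro
      poisson_bracket_axioms.intro contact_bracket_axioms.intro lie_bracket_axioms.intro
      bracket_axioms.intro square_zero_algebra)
    fix f g h k
    assume "f \<in> carrier ?S" "g \<in> carrier ?S" "h \<in> carrier ?S"
    then have c: "\<And>i. f i \<in> carrier R" "\<And>i. g i \<in> carrier R" "\<And>i. h i \<in> carrier R"
      by (simp_all add: s)
    show "log_canonical_bracket R (f \<oplus>\<^bsub>?S\<^esub> g) h = log_canonical_bracket R f h \<oplus>\<^bsub>?S\<^esub> log_canonical_bracket R g h"
      using c by (simp add: s) algebra
    show "log_canonical_bracket R f (g \<oplus>\<^bsub>?S\<^esub> h) = log_canonical_bracket R f g \<oplus>\<^bsub>?S\<^esub> log_canonical_bracket R f h"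
      using c by (simp add: s) algebra
    show "log_canonical_bracket R (f \<otimes>\<^bsub>?S\<^esub> g) h = log_canonical_bracket R f h \<otimes>\<^bsub>?S\<^esub> g \<oplus>\<^bsub>?S\<^esub>
        log_canonical_bracket R g h \<otimes>\<^bsub>?S\<^esub> f \<oplus>\<^bsub>?S\<^esub> log_canonical_bracket R h \<one>\<^bsub>?S\<^esub> \<otimes>\<^bsub>?S\<^esub> f \<otimes>\<^bsub>?S\<^esub> g"
      using c by (simp add: s) algebra
    show "log_canonical_bracket R f (log_canonical_bracket R g h) \<oplus>\<^bsub>?S\<^esub> log_canonical_bracket R g (log_canonical_bracket R h f)
        \<oplus>\<^bsub>?S\<^esub> log_canonical_bracket R h (log_canonical_bracket R f g) = \<zero>\<^bsub>?S\<^esub>"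
      using c by (simp add: s a_minus_def)
    assume k: "k \<in> carrier R"
    show "log_canonical_bracket R (k \<odot>\<^bsub>?S\<^esub> f) g = k \<odot>\<^bsub>?S\<^esub> log_canonical_bracket R f g"
      using c k by (simp add: s) algebra
    show "log_canonical_bracket R f (k \<odot>\<^bsub>?S\<^esub> g) = k \<odot>\<^bsub>?S\<^esub> log_canonical_bracket R f g"
      using c k by (simp add: s) algebra
  next
    show "log_canonical_bracket R f f = \<zero>\<^bsub>?S\<^esub>" if "f \<in> carrier ?S" for f
      using that by (simp add: s) algebra
  qed (simp_all add: s)
qed

lemma euler_contact: "contact_bracket R (square_zero_algebra R 2) (euler_bracket R)"
proof -
  let ?S = "square_zero_algebra R 2"
  note s = square_zero_algebra_simps euler_bracket_def fun_eq_iff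
  show ?thesis
  proof (intro poisson_bracket.intro contact_bracket.intro lie_bracket.intro bracket.intro
      poisson_bracket_axioms.intro contact_bracket_axioms.intro lie_bracket_axioms.intro
      bracket_axioms.intro square_zero_algebra)
    fix f g h k
    assume "f \<in> carrier ?S" "g \<in> carrier ?S" "h \<in> carrier ?S"
    then have c: "\<And>i. f i \<in> carrier R" "\<And>i. g i \<in> carrier R" "\<And>i. h i \<in> carrier R"
      and z: "\<And>i. i \<ge> 2 \<Longrightarrow> f i = \<zero>" "\<And>i. i \<ge> 2 \<Longrightarrow> g i = \<zero>"
      by (simp_all add: s)
    show "euler_bracket R (f \<oplus>\<^bsub>?S\<^esub> g) h = euler_bracket R f h \<oplus>\<^bsub>?S\<^esub> euler_bracket R g h"
      using c by (simp add: s) algebra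
    show "euler_bracket R f (g \<oplus>\<^bsub>?S\<^esub> h) = euler_bracket R f g \<oplus>\<^bsub>?S\<^esub> euler_bracket R f h"
      using c by (simp add: s) algebra
    show "euler_bracket R (f \<otimes>\<^bsub>?S\<^esub> g) h = euler_bracket R f h \<otimes>\<^bsub>?S\<^esub> g \<oplus>\<^bsub>?S\<^esub>
        euler_bracket R g h \<otimes>\<^bsub>?S\<^esub> f \<oplus>\<^bsub>?S\<^esub> euler_bracket R h \<one>\<^bsub>?S\<^esub> \<otimes>\<^bsub>?S\<^esub> f \<otimes>\<^bsub>?S\<^esub> g"
      using c z by (simp add: s) algebra
    show "euler_bracket R f (euler_bracket R g h) \<oplus>\<^bsub>?S\<^esub> euler_bracket R g (euler_bracket R h f)
        \<oplus>\<^bsub>?S\<^esub> euler_bracket R h (euler_bracket R f g) = \<zero>\<^bsub>?S\<^esub>"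
      using c by (simp add: s) algebra
    assume k: "k \<in> carrier R"
    show "euler_bracket R (k \<odot>\<^bsub>?S\<^esub> f) g = k \<odot>\<^bsub>?S\<^esub> euler_bracket R f g"
      using c k by (simp add: s) algebra
    show "euler_bracket R f (k \<odot>\<^bsub>?S\<^esub> g) = k \<odot>\<^bsub>?S\<^esub> euler_bracket R f g"
      using c k by (simp add: s) algebra
  next
    show "euler_bracket R f f = \<zero>\<^bsub>?S\<^esub>" if "f \<in> carrier ?S" for f
      using that by (simp add: s) algebra
  qed (simp_all add: s)
qed

end

section \<open>The brackets have no common extension\<close>

lemma (in domain) no_extension:
  defines "A \<equiv> square_zero_algebra R 4" and "B \<equiv> square_zero_algebra R 2"
  assumes br: "contact_bracket R (tensor_product R A B) br"
    and ext: "extends_brackets R A B (log_canonical_bracket R) (euler_bracket R) br"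
  shows False
proof -
  \<comment> \<open>the monomial at position \<open>j\<close>: \<open>e 1\<close> is \<open>x\<close> in \<open>A\<close> and \<open>\<epsilon>\<close> in \<open>B\<close>, and \<open>e 2\<close> is \<open>y\<close>\<close>
  define e where "e j = (\<lambda>i. if i = j then \<one> else \<zero>)" for j :: nat
  note s = square_zero_algebra_simps[where n = 4, folded A_def] square_zero_algebra_simps[where n = 2, folded B_def]
    e_def fun_eq_iff log_canonical_bracket_def euler_bracket_def
  have "tensor R A B"
    unfolding tensor_def A_def B_def by (simp add: square_zero_algebra)
  moreover have "poisson_bracket R A (log_canonical_bracket R)"
    unfolding A_def by (rule log_canonical_poisson)
  moreover have "contact_bracket R B (euler_bracket R)"
    unfolding B_def by (rule euler_contact)
  ultimately interpret dual_number_extension R A B "log_canonical_bracket R" "euler_bracket R" br "e 1" "\<lambda>b. b 1"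
  proof (intro dual_number_extension.intro dual_number_extension_axioms.intro br ext)
    show "e 1 \<in> carrier B" by (simp add: s)
    show "euler_bracket R (e 1) \<one>\<^bsub>B\<^esub> = e 1" by (simp add: s a_minus_def)
    fix b assume b: "b \<in> carrier B"
    have "b = b 0 \<odot>\<^bsub>B\<^esub> \<one>\<^bsub>B\<^esub> \<oplus>\<^bsub>B\<^esub> b 1 \<odot>\<^bsub>B\<^esub> e 1"
      using b by (auto simp: s)
    moreover have "b 0 \<in> carrier R" using b by (simp add: s)
    ultimately show "\<exists>k\<in>carrier R. b = k \<odot>\<^bsub>B\<^esub> \<one>\<^bsub>B\<^esub> \<oplus>\<^bsub>B\<^esub> b 1 \<odot>\<^bsub>B\<^esub> e 1"
      by (rule bexI)
  qed (simp_all add: s)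
  obtain P where Pc: "P \<in> carrier A \<rightarrow> carrier A"
    and Pm: "\<And>a b. \<lbrakk>a \<in> carrier A; b \<in> carrier A\<rbrakk> \<Longrightarrow>
      P (a \<otimes>\<^bsub>A\<^esub> b) = P a \<otimes>\<^bsub>A\<^esub> b \<oplus>\<^bsub>A\<^esub> P b \<otimes>\<^bsub>A\<^esub> a \<oplus>\<^bsub>A\<^esub> a \<otimes>\<^bsub>A\<^esub> b"
    and Pb: "\<And>a b. \<lbrakk>a \<in> carrier A; b \<in> carrier A\<rbrakk> \<Longrightarrow>
      P (log_canonical_bracket R a b) = log_canonical_bracket R (P a) b \<oplus>\<^bsub>A\<^esub> log_canonical_bracket R a (P b)"
    using ex_twisted_derivation by blast
  let ?x = "e 1" and ?y = "e 2"
  have xy: "?x \<in> carrier A" "?y \<in> carrier A" by (simp_all add: s)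
  have c: "P ?x i \<in> carrier R" "P ?y i \<in> carrier R" for i
    using funcset_mem[OF Pc xy(1)] funcset_mem[OF Pc xy(2)] by (simp_all add: s)
  have prod: "log_canonical_bracket R ?x ?y = ?x \<otimes>\<^bsub>A\<^esub> ?y" by (simp add: s a_minus_def)
  \<comment> \<open>the coefficient of \<open>xy\<close> in \<open>P(xy)\<close>, from the product rule and from the bracket rule\<close>
  have "P (?x \<otimes>\<^bsub>A\<^esub> ?y) 3 = P ?x 1 \<oplus> P ?y 2 \<oplus> \<one>"
    using fun_cong[OF Pm[OF xy], of 3] c by (simp add: s)
  moreover have "P (?x \<otimes>\<^bsub>A\<^esub> ?y) 3 = P ?x 1 \<oplus> P ?y 2"
    using fun_cong[OF Pb[OF xy], of 3] c unfolding prod by (simp add: s a_minus_def)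
  ultimately have "P ?x 1 \<oplus> P ?y 2 \<oplus> \<one> = P ?x 1 \<oplus> P ?y 2 \<oplus> \<zero>"
    using c by simp
  then have "\<one> = \<zero>" using c by (simp del: r_zero)
  then show False by simp
qed

theorem theorem1:
  fixes K :: "('k, 'm) ring_scheme"
  assumes "field K"
    and "ring_char K \<noteq> 2"
  shows "\<exists>(A :: ('k, nat \<Rightarrow> 'k) module) (B :: ('k, nat \<Rightarrow> 'k) module) brA brB.
    algebra K A \<and> algebra K B \<and>
    poisson_bracket K A brA \<and> contact_bracket K B brB \<and>
    \<not> (\<exists>br. contact_bracket K (tensor_product K A B) br \<and> extends_brackets K A B brA brB br)"
proof -
  interpret field K by fact
  show ?thesis
    using square_zero_algebra[of 4] square_zero_algebra[of 2] log_canonical_poisson euler_contact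
      no_extension by blast
qed

end
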